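(* Let $Q$ be a smooth manifold, $(\Omega,\mathcal{F},P)$ a probability space, $[a,b]\subset\mathbb{R}$, $N\geq 2$, $h=(b-a)/N$ and $t_k=a+hk$. Let $L_d:\mathbb{R}\times\Omega\times Q\times Q\to\mathbb{R}$ be a stochastic discrete Lagrangian, sufficiently smooth in its last two arguments. Assume that almost surely the stochastic discrete Euler-Lagrange equations $$D_3L_d(t_k,\omega,q_k,q_{k+1})+D_4L_d(t_{k-1},\omega,q_{k-1},q_k)=0,\qquad k=1,\dots,N-1,$$ have, for each initial condition $(q_0,q_1)\in Q\times Q$, a unique solution $\{q_k\}_{k=0}^N$, depending smoothly on $(q_0,q_1)$. Then almost surely the discrete flow $(q_0,q_1)\mapsto(q_{N-1},q_N)$ is symplectic, in the sense that it preserves the discrete symplectic form: for all $(q_0,q_1)$ and all first variations $(\delta q_0^1,\delta q_1^1),(\delta q_0^2,\delta q_1^2)$ of the initial condition, with induced variations $(\delta q_{N-1}^j,\delta q_N^j)$, $j=1,2$, $$\Omega_{L_d}(t_{N-1},\omega,q_{N-1},q_N)\big((\delta q_{N-1}^1,\delta q_N^1),(\delta q_{N-1}^2,\delta q_N^2)\big)=\Omega_{L_d}(t_0,\omega,q_0,q_1)\big((\delta q_0^1,\delta q_1^1),(\delta q_0^2,\delta q_1^2)\big).$$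
   Context: The stochastic discrete Lagrangian has the form $L_d(t_k,\omega,q_k,q_{k+1})=\mathcal{L}_d(q_k,q_{k+1})+B_d(t_k,q_k,q_{k+1},\omega)$, where $\mathcal{L}_d:Q\times Q\to\mathbb{R}$ is a given discrete Lagrangian and $B_d(t_k,q_k,q_{k+1},\omega)\,h$ is a given random approximation of the sum of Stratonovich integrals $\sum_{i=1}^m\int_{t_k}^{t_{k+1}}\gamma_i(q(t))\circ dW_i$ for given potentials $\gamma_i:Q\to\mathbb{R}$ and independent Wiener processes $W_i$. The stochastic discrete Euler-Lagrange equations are the stationarity conditions of the action sum $\sum_{k=0}^{N-1}L_d(t_k,\omega,q_k,q_{k+1})h$ under variations with $q_0,q_N$ fixed. $D_3L_d$ and $D_4L_d$ denote the differentials of $L_d(t,\omega,\cdot,\cdot)$ in its first and second $Q$-argument, respectively. The left and right one-forms on $Q\times Q$ (for fixed $t_k,\omega$) are $$\Theta^+(t_k,\omega,q_k,q_{k+1})\cdot(\delta q_k,\delta q_{k+1})=D_4L_d(t_k,\omega,q_k,q_{k+1})\cdot\delta q_{k+1},$$ $$\Theta^-(t_k,\omega,q_k,q_{k+1})\cdot(\delta q_k,\delta q_{k+1})=D_3L_d(t_k,\omega,q_k,q_{k+1})\cdot\delta q_k.$$ Since $\mathbf{d}L_d=\Theta^++\Theta^-$ (exterior derivative on $Q\times Q$), $\mathbf{d}\Theta^+=-\mathbf{d}\Theta^-$, and the discrete symplectic form is the two-form $\Omega_{L_d}:=\mathbf{d}\Theta^+=-\mathbf{d}\Theta^-$ on $Q\times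 Q$, for each $t_k,\omega$. *)

theory Defs
  imports "HOL-Probability.Probability"
begin

section \<open>Differentiability classes on open sets\<close>

text \<open>
  Only meant for open \<open>S\<close>. In finite dimension, continuity of all iterated directional
  derivatives of order \<open>\<le> n\<close> of Frechet differentiable functions is the usual class \<open>C\<^sup>n\<close>.
\<close>

primrec n_times_cont_diff_on ::
  "nat \<Rightarrow> 'a::euclidean_space set \<Rightarrow> ('a \<Rightarrow> 'b::euclidean_space) \<Rightarrow> bool" where
  "n_times_cont_diff_on 0 S f \<longleftrightarrow> continuous_on S f"
| "n_times_cont_diff_on (Suc n) S f \<longleftrightarrow>
     (\<forall>x\<in>S. f differentiable at x) \<and>
     (\<forall>v. n_times_cont_diff_on n S (\<lambda>x. frechet_derivative f (at x) v))"

definition C_class_on ::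
  "enat \<Rightarrow> 'a::euclidean_space set \<Rightarrow> ('a \<Rightarrow> 'b::euclidean_space) \<Rightarrow> bool" where
  "C_class_on r S f \<longleftrightarrow> (\<forall>n. enat n \<le> r \<longrightarrow> n_times_cont_diff_on n S f)"


section \<open>Smooth manifolds\<close>

text \<open>
  A chart is a pair of its domain and its coordinate map; the values of the coordinate map
  outside the domain are irrelevant. Atlases are not required to be maximal.
\<close>

type_synonym ('q, 'e) chart = "'q set \<times> ('q \<Rightarrow> 'e)"

record ('q, 'e) mfd =
  mfd_top :: "'q topology"
  mfd_atlas :: "('q, 'e) chart set"

abbreviation points :: "('q, 'e) mfd \<Rightarrow> 'q set" where
  "points M \<equiv> topspace (mfd_top M)"

definition is_chart :: "'q topology \<Rightarrow> ('q, 'e::euclidean_space) chart \<Rightarrow> bool" where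
  "is_chart X c \<longleftrightarrow> openin X (fst c) \<and> open (snd c ` fst c) \<and>
     homeomorphic_map (subtopology X (fst c)) (top_of_set (snd c ` fst c)) (snd c)"

definition chart_inv :: "('q, 'e) chart \<Rightarrow> 'e \<Rightarrow> 'q" where
  "chart_inv c = inv_into (fst c) (snd c)"

definition transition :: "('q, 'e) chart \<Rightarrow> ('q, 'e) chart \<Rightarrow> 'e \<Rightarrow> 'e" where
  "transition c d = snd d \<circ> chart_inv c"

definition smooth_manifold :: "('q, 'e::euclidean_space) mfd \<Rightarrow> bool" where
  "smooth_manifold M \<longleftrightarrow>
     Hausdorff_space (mfd_top M) \<and> second_countable (mfd_top M) \<and>
     (\<forall>c\<in>mfd_atlas M. is_chart (mfd_top M) c) \<and>
     (\<Union>c\<in>mfd_atlas M. fst c) = points M \<and>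
     (\<forall>c\<in>mfd_atlas M. \<forall>d\<in>mfd_atlas M.
        C_class_on \<infinity> (snd c ` (fst c \<inter> fst d)) (transition c d))"

definition prod_mfd :: "('q, 'e) mfd \<Rightarrow> ('p, 'f) mfd \<Rightarrow> ('q \<times> 'p, 'e \<times> 'f) mfd" where
  "prod_mfd M N =
     \<lparr> mfd_top = prod_topology (mfd_top M) (mfd_top N),
       mfd_atlas = {(fst c \<times> fst d, map_prod (snd c) (snd d)) | c d.
                      c \<in> mfd_atlas M \<and> d \<in> mfd_atlas N} \<rparr>"

definition real_mfd :: "(real, real) mfd" where
  "real_mfd = \<lparr> mfd_top = euclidean, mfd_atlas = {(UNIV, id)} \<rparr>"

definition C_class_map ::
  "enat \<Rightarrow> ('q, 'e::euclidean_space) mfd \<Rightarrow> ('p, 'f::euclidean_space) mfd \<Rightarrow> ('q \<Rightarrow> 'p) \<Rightarrow> bool" where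
  "C_class_map r M N F \<longleftrightarrow>
     continuous_map (mfd_top M) (mfd_top N) F \<and>
     (\<forall>c\<in>mfd_atlas M. \<forall>d\<in>mfd_atlas N.
        C_class_on r (snd c ` (fst c \<inter> F -` fst d)) (snd d \<circ> F \<circ> chart_inv c))"


section \<open>Tangent vectors, differentials and exterior derivative\<close>

definition charts_at :: "('q, 'e) mfd \<Rightarrow> 'q \<Rightarrow> ('q, 'e) chart set" where
  "charts_at M p = {c \<in> mfd_atlas M. p \<in> fst c}"

definition some_chart_at :: "('q, 'e) mfd \<Rightarrow> 'q \<Rightarrow> ('q, 'e) chart" where
  "some_chart_at M p = (SOME c. c \<in> charts_at M p)"

text \<open>
  A tangent vector at \<open>p\<close> is the family of its coordinate vectors in all charts around \<open>p\<close>,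
  related by the derivatives of the transition maps. The value 0 at charts not containing \<open>p\<close>
  makes the representation unique and closed under pointwise linear combinations.
\<close>

type_synonym ('q, 'e) tvec = "('q, 'e) chart \<Rightarrow> 'e"

definition tangent_space :: "('q, 'e::euclidean_space) mfd \<Rightarrow> 'q \<Rightarrow> ('q, 'e) tvec set" where
  "tangent_space M p =
     {v. (\<forall>c\<in>charts_at M p. \<forall>d\<in>charts_at M p.
            v d = frechet_derivative (transition c d) (at (snd c p)) (v c)) \<and>
         (\<forall>c. c \<notin> charts_at M p \<longrightarrow> v c = 0)}"

text \<open>The tangent vector at \<open>p\<close> whose coordinate vector in the chart \<open>c\<close> is \<open>w\<close>.\<close>

definition tvec_of_coord ::
  "('q, 'e::euclidean_space) mfd \<Rightarrow> ('q, 'e) chart \<Rightarrow> 'q \<Rightarrow> 'e \<Rightarrow> ('q, 'e) tvec" where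
  "tvec_of_coord M c p w =
     (\<lambda>d. if d \<in> charts_at M p
          then frechet_derivative (transition c d) (at (snd c p)) w else 0)"

text \<open>
  The differential of \<open>F\<close> at \<open>p\<close>. By the chain rule it does not depend on the chart chosen at \<open>p\<close>.
\<close>

definition push_forward ::
  "('q, 'e::euclidean_space) mfd \<Rightarrow> ('p, 'f::euclidean_space) mfd \<Rightarrow> ('q \<Rightarrow> 'p) \<Rightarrow>
     'q \<Rightarrow> ('q, 'e) tvec \<Rightarrow> ('p, 'f) tvec" where
  "push_forward M N F p v =
     (let c = some_chart_at M p in
      (\<lambda>d. if d \<in> charts_at N (F p)
           then frechet_derivative (snd d \<circ> F \<circ> chart_inv c) (at (snd c p)) (v c) else 0))"

text \<open>
  The differential of a real function as a covector, through the canonical identification of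
  the tangent spaces of the real line with the real line.
\<close>

definition differential ::
  "('q, 'e::euclidean_space) mfd \<Rightarrow> ('q \<Rightarrow> real) \<Rightarrow> 'q \<Rightarrow> ('q, 'e) tvec \<Rightarrow> real" where
  "differential M f p v = push_forward M real_mfd f p v (UNIV, id)"

text \<open>
  In coordinates \<open>\<alpha> = \<Sum>\<^sub>i \<alpha>\<^sub>i dx\<^sub>i\<close> has exterior derivative
  \<open>d\<alpha>(u, v) = \<Sum>\<^sub>i\<^sub>j \<partial>\<^sub>i\<alpha>\<^sub>j (u\<^sub>i v\<^sub>j - v\<^sub>i u\<^sub>j)\<close>, and this expression is the same in all charts.
\<close>

type_synonym ('q, 'e) one_form = "'q \<Rightarrow> ('q, 'e) tvec \<Rightarrow> real"

type_synonym ('q, 'e) two_form = "'q \<Rightarrow> ('q, 'e) tvec \<Rightarrow> ('q, 'e) tvec \<Rightarrow> real"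

definition coord_one_form ::
  "('q, 'e::euclidean_space) mfd \<Rightarrow> ('q, 'e) chart \<Rightarrow> ('q, 'e) one_form \<Rightarrow> 'e \<Rightarrow> 'e \<Rightarrow> real" where
  "coord_one_form M c \<alpha> x w = \<alpha> (chart_inv c x) (tvec_of_coord M c (chart_inv c x) w)"

definition ext_deriv ::
  "('q, 'e::euclidean_space) mfd \<Rightarrow> ('q, 'e) one_form \<Rightarrow> ('q, 'e) two_form" where
  "ext_deriv M \<alpha> p u v =
     (let c = some_chart_at M p in
        frechet_derivative (\<lambda>x. coord_one_form M c \<alpha> x (v c)) (at (snd c p)) (u c)
      - frechet_derivative (\<lambda>x. coord_one_form M c \<alpha> x (u c)) (at (snd c p)) (v c))"


section \<open>Stochastic discrete Lagrangian mechanics\<close>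

type_synonym ('w, 'q) lagrangian = "real \<Rightarrow> 'w \<Rightarrow> 'q \<Rightarrow> 'q \<Rightarrow> real"

text \<open>
  The random part \<open>B\<close> is an arbitrary random function: being an approximation of a
  Stratonovich integral carries no error bound and hence imposes no condition on it.
\<close>

definition stochastic_discrete_lagrangian ::
  "'w measure \<Rightarrow> ('q, 'e) mfd \<Rightarrow> ('q \<Rightarrow> 'q \<Rightarrow> real) \<Rightarrow> (real \<Rightarrow> 'q \<Rightarrow> 'q \<Rightarrow> 'w \<Rightarrow> real) \<Rightarrow>
     ('w, 'q) lagrangian \<Rightarrow> bool" where
  "stochastic_discrete_lagrangian P Q L0 B L \<longleftrightarrow>
     (\<forall>t. \<forall>q\<in>points Q. \<forall>q'\<in>points Q. B t q q' \<in> borel_measurable P) \<and>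
     (\<forall>t. \<forall>\<omega>\<in>space P. \<forall>q\<in>points Q. \<forall>q'\<in>points Q. L t \<omega> q q' = L0 q q' + B t q q' \<omega>)"

definition D3 ::
  "('q, 'e::euclidean_space) mfd \<Rightarrow> ('w, 'q) lagrangian \<Rightarrow> real \<Rightarrow> 'w \<Rightarrow> 'q \<Rightarrow> 'q \<Rightarrow>
     ('q, 'e) tvec \<Rightarrow> real" where
  "D3 Q L t \<omega> q q' = differential Q (\<lambda>x. L t \<omega> x q') q"

definition D4 ::
  "('q, 'e::euclidean_space) mfd \<Rightarrow> ('w, 'q) lagrangian \<Rightarrow> real \<Rightarrow> 'w \<Rightarrow> 'q \<Rightarrow> 'q \<Rightarrow>
     ('q, 'e) tvec \<Rightarrow> real" where
  "D4 Q L t \<omega> q q' = differential Q (\<lambda>x. L t \<omega> q x) q'"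

text \<open>
  A tangent vector \<open>w\<close> of \<open>Q \<times> Q\<close> stands for the pair of variations
  \<open>(\<delta>q\<^sub>k, \<delta>q\<^sub>k\<^sub>+\<^sub>1)\<close> obtained by pushing \<open>w\<close> forward along the two projections.
\<close>

definition Theta_plus ::
  "('q, 'e::euclidean_space) mfd \<Rightarrow> ('w, 'q) lagrangian \<Rightarrow> real \<Rightarrow> 'w \<Rightarrow>
     ('q \<times> 'q, 'e \<times> 'e) one_form" where
  "Theta_plus Q L t \<omega> = (\<lambda>x w. D4 Q L t \<omega> (fst x) (snd x) (push_forward (prod_mfd Q Q) Q snd x w))"

definition Omega_Ld ::
  "('q, 'e::euclidean_space) mfd \<Rightarrow> ('w, 'q) lagrangian \<Rightarrow> real \<Rightarrow> 'w \<Rightarrow>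
     ('q \<times> 'q, 'e \<times> 'e) two_form" where
  "Omega_Ld Q L t \<omega> = ext_deriv (prod_mfd Q Q) (Theta_plus Q L t \<omega>)"

definition grid :: "real \<Rightarrow> real \<Rightarrow> nat \<Rightarrow> nat \<Rightarrow> real" where
  "grid a b N k = a + (b - a) / real N * real k"

text \<open>Solutions are extensional on \<open>{0..N}\<close>, so that uniqueness is meaningful.\<close>

definition DEL_solution ::
  "('q, 'e::euclidean_space) mfd \<Rightarrow> ('w, 'q) lagrangian \<Rightarrow> real \<Rightarrow> real \<Rightarrow> nat \<Rightarrow> 'w \<Rightarrow>
     'q \<Rightarrow> 'q \<Rightarrow> (nat \<Rightarrow> 'q) \<Rightarrow> bool" where
  "DEL_solution Q L a b N \<omega> q0 q1 q \<longleftrightarrow>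
     q \<in> {0..N} \<rightarrow>\<^sub>E points Q \<and> q 0 = q0 \<and> q 1 = q1 \<and>
     (\<forall>k\<in>{1..N - 1}. \<forall>v\<in>tangent_space Q (q k).
        D3 Q L (grid a b N k) \<omega> (q k) (q (k + 1)) v
        + D4 Q L (grid a b N (k - 1)) \<omega> (q (k - 1)) (q k) v = 0)"

definition DEL_path ::
  "('q, 'e::euclidean_space) mfd \<Rightarrow> ('w, 'q) lagrangian \<Rightarrow> real \<Rightarrow> real \<Rightarrow> nat \<Rightarrow> 'w \<Rightarrow>
     'q \<times> 'q \<Rightarrow> nat \<Rightarrow> 'q" where
  "DEL_path Q L a b N \<omega> x = (THE q. DEL_solution Q L a b N \<omega> (fst x) (snd x) q)"

definition discrete_flow ::
  "('q, 'e::euclidean_space) mfd \<Rightarrow> ('w, 'q) lagrangian \<Rightarrow> real \<Rightarrow> real \<Rightarrow> nat \<Rightarrow> 'w \<Rightarrow>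
     'q \<times> 'q \<Rightarrow> 'q \<times> 'q" where
  "discrete_flow Q L a b N \<omega> x = (DEL_path Q L a b N \<omega> x (N - 1), DEL_path Q L a b N \<omega> x N)"

end

theory Submission
  imports Defs
begin

text \<open>
  In product charts, \<open>\<Omega>\<close> is the antisymmetrization of the mixed second derivative of the
  Lagrangian, \<open>D\<^sub>1D\<^sub>2L(\<delta>\<^sup>1q\<^sub>k, \<delta>\<^sup>2q\<^sub>k\<^sub>+\<^sub>1) - D\<^sub>1D\<^sub>2L(\<delta>\<^sup>2q\<^sub>k, \<delta>\<^sup>1q\<^sub>k\<^sub>+\<^sub>1)\<close>. Differentiating the \<open>k\<close>-th
  Euler-Lagrange equation along \<open>\<delta>\<^sup>1\<close>, pairing with \<open>\<delta>\<^sup>2q\<^sub>k\<close> and antisymmetrizing cancels the pure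
  second derivatives and leaves \<open>\<Omega>\<close> at step \<open>k - 1\<close> equal to \<open>\<Omega>\<close> at step \<open>k\<close>. Compared with
  taking the exterior derivative of the action along solutions, this only requires the flow to be
  once differentiable, which is all that is available when \<open>r = 2\<close>.
\<close>

section \<open>Second derivatives\<close>

text \<open>Built from the same directional derivatives as \<open>n_times_cont_diff_on\<close>, so
  that continuity for class 2 can be read off. \<open>v\<close> is the inner direction and
  \<open>u\<close> the outer one; symmetry has to be proved.\<close>

definition hessian :: "('a::euclidean_space \<Rightarrow> real) \<Rightarrow> 'a \<Rightarrow> 'a \<Rightarrow> 'a \<Rightarrow> real" where
  "hessian f x u v = frechet_derivative (\<lambda>y. frechet_derivative f (at y) v) (at x) u"

lemma n_times_cont_diff_on_2D:
  fixes f :: "'a::euclidean_space \<Rightarrow> real"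
  assumes "n_times_cont_diff_on 2 S f"
  shows "\<And>x. x \<in> S \<Longrightarrow> f differentiable at x"
    and "\<And>x v. x \<in> S \<Longrightarrow> (\<lambda>y. frechet_derivative f (at y) v) differentiable at x"
    and "\<And>u v. continuous_on S (\<lambda>x. hessian f x u v)"
  using assms by (simp_all add: numeral_2_eq_2 hessian_def)

lemma hessian_works:
  assumes "n_times_cont_diff_on 2 S f" "x \<in> S"
  shows "((\<lambda>y. frechet_derivative f (at y) v) has_derivative (\<lambda>u. hessian f x u v)) (at x)"
  using n_times_cont_diff_on_2D(2)[OF assms, of v]
  by (simp add: frechet_derivative_works hessian_def[abs_def])

section \<open>Symmetry of second derivatives\<close>

lemma has_derivative_unique_apply:
  assumes "(f has_derivative F) (at x)" "(f has_derivative G) (at x)"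
  shows "F u = G u"
  using has_derivative_unique[OF assms] by simp

text \<open>The mean value theorem, applied first along \<open>u\<close> and then along
  \<open>v\<close>, leaves one intermediate parameter each time; together they give the point
  \<open>p\<close> of the parallelogram.\<close>

lemma second_difference_eq_hessian:
  fixes f :: "'a::euclidean_space \<Rightarrow> real"
  assumes f: "n_times_cont_diff_on 2 (ball x d) f" and s: "0 < s" "s * (norm u + norm v) < d"
  obtains p where "norm (p - x) \<le> s * (norm u + norm v)"
    "f (x + s *\<^sub>R u + s *\<^sub>R v) - f (x + s *\<^sub>R u) - f (x + s *\<^sub>R v) + f x = s * (s * hessian f p v u)"
proof -
  have nb: "norm (i *\<^sub>R u + j *\<^sub>R v) \<le> s * (norm u + norm v)"
    if "0 \<le> i" "i \<le> s" "0 \<le> j" "j \<le> s" for i j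
  proof -
    have "norm (i *\<^sub>R u + j *\<^sub>R v) \<le> i * norm u + j * norm v"
      using norm_triangle_ineq[of "i *\<^sub>R u" "j *\<^sub>R v"] that by simp
    also have "\<dots> \<le> s * norm u + s * norm v"
      using that by (intro add_mono mult_right_mono) auto
    finally show ?thesis by (simp add: algebra_simps)
  qed
  have inb: "x + i *\<^sub>R u + j *\<^sub>R v \<in> ball x d" if "0 \<le> i" "i \<le> s" "0 \<le> j" "j \<le> s" for i j
    using nb[OF that] s(2) dist_norm[of "x + (i *\<^sub>R u + j *\<^sub>R v)" x] by (simp add: dist_commute add.assoc)
  have df: "(f has_derivative frechet_derivative f (at y)) (at y)" if "y \<in> ball x d" for y
    using n_times_cont_diff_on_2D(1)[OF f that] by (simp add: frechet_derivative_works)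
  \<comment> \<open>The increment in direction \<open>v\<close> as a function of the displacement
    along \<open>u\<close>; the second difference is \<open>g s - g 0\<close>. The term
    \<open>0 *\<^sub>R v\<close> keeps both summands in one family indexed by
    \<open>j\<close>.\<close>
  define g where "g i = f (x + i *\<^sub>R u + s *\<^sub>R v) - f (x + i *\<^sub>R u + 0 *\<^sub>R v)" for i
  have dg: "(g has_real_derivative frechet_derivative f (at (x + i *\<^sub>R u + s *\<^sub>R v)) u
      - frechet_derivative f (at (x + i *\<^sub>R u + 0 *\<^sub>R v)) u) (at i)" if i: "0 \<le> i" "i \<le> s" for i
  proof -
    have j: "((\<lambda>i. f (x + i *\<^sub>R u + j *\<^sub>R v)) has_derivative
        (\<lambda>h. frechet_derivative f (at (x + i *\<^sub>R u + j *\<^sub>R v)) (h *\<^sub>R u))) (at i)" if "0 \<le> j" "j \<le> s" for j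
      by (rule has_derivative_compose[where f = "\<lambda>i. x + i *\<^sub>R u + j *\<^sub>R v", OF _ df[OF inb[OF i that]]])
        (auto intro!: derivative_eq_intros)
    have lin: "frechet_derivative f (at (x + i *\<^sub>R u + j *\<^sub>R v)) (h *\<^sub>R u)
        = h * frechet_derivative f (at (x + i *\<^sub>R u + j *\<^sub>R v)) u" if "0 \<le> j" "j \<le> s" for j h
      using has_derivative_linear[OF df[OF inb[OF i that]]] by (simp add: linear_cmul)
    have "(g has_derivative (\<lambda>h. h * frechet_derivative f (at (x + i *\<^sub>R u + s *\<^sub>R v)) u
      - h * frechet_derivative f (at (x + i *\<^sub>R u + 0 *\<^sub>R v)) u)) (at i)"
      unfolding g_def using has_derivative_diff[OF j[of s] j[of 0]] lin[of s] lin[of 0] s by simp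
    then show ?thesis
      by (rule has_derivative_imp_has_field_derivative) (simp add: algebra_simps)
  qed
  obtain i where i: "0 < i" "i < s" and gi: "g s - g 0 = (s - 0) *
     (frechet_derivative f (at (x + i *\<^sub>R u + s *\<^sub>R v)) u
      - frechet_derivative f (at (x + i *\<^sub>R u + 0 *\<^sub>R v)) u)"
    using MVT2[OF s(1) dg] by auto
  \<comment> \<open>With \<open>i\<close> frozen, the two derivatives in \<open>gi\<close> are the
    values at \<open>j = s\<close> and \<open>j = 0\<close> of one function, to which the mean value
    theorem applies again.\<close>
  have dk: "((\<lambda>j. frechet_derivative f (at (x + i *\<^sub>R u + j *\<^sub>R v)) u) has_real_derivative
      hessian f (x + i *\<^sub>R u + j *\<^sub>R v) v u) (at j)" if j: "0 \<le> j" "j \<le> s" for j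
  proof -
    have *: "((\<lambda>j. frechet_derivative f (at (x + i *\<^sub>R u + j *\<^sub>R v)) u) has_derivative
      (\<lambda>h. hessian f (x + i *\<^sub>R u + j *\<^sub>R v) (h *\<^sub>R v) u)) (at j)"
      by (rule has_derivative_compose[where f = "\<lambda>j. x + i *\<^sub>R u + j *\<^sub>R v", OF _ hessian_works[OF f inb]])
        (use i j in \<open>auto intro!: derivative_eq_intros\<close>)
    have "hessian f (x + i *\<^sub>R u + j *\<^sub>R v) (h *\<^sub>R v) u = hessian f (x + i *\<^sub>R u + j *\<^sub>R v) v u * h" for h
      using linear_cmul[OF has_derivative_linear[OF hessian_works[OF f inb, of i j u]], of h v] i j
      by (simp add: mult.commute)
    with * show ?thesis by (simp add: has_field_derivative_def)
  qed
  obtain j where j: "0 < j" "j < s" and gj: "frechet_derivative f (at (x + i *\<^sub>R u + s *\<^sub>R v)) u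
      - frechet_derivative f (at (x + i *\<^sub>R u + 0 *\<^sub>R v)) u
      = (s - 0) * hessian f (x + i *\<^sub>R u + j *\<^sub>R v) v u"
    using MVT2[OF s(1) dk] by auto
  show ?thesis
  proof (rule that[of "x + i *\<^sub>R u + j *\<^sub>R v"])
    show "norm (x + i *\<^sub>R u + j *\<^sub>R v - x) \<le> s * (norm u + norm v)"
      using nb[of i j] i j by (simp add: add.assoc)
    show "f (x + s *\<^sub>R u + s *\<^sub>R v) - f (x + s *\<^sub>R u) - f (x + s *\<^sub>R v) + f x
      = s * (s * hessian f (x + i *\<^sub>R u + j *\<^sub>R v) v u)"
      using gi unfolding gj by (simp add: g_def)
  qed
qed

lemma n_times_cont_diff_on_subset:
  assumes "n_times_cont_diff_on n S f" "T \<subseteq> S"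
  shows "n_times_cont_diff_on n T f"
  using assms by (induction n arbitrary: f) (auto intro: continuous_on_subset)

text \<open>The second difference is unchanged when \<open>u\<close> and \<open>v\<close> are
  exchanged, so it evaluates the two orders of differentiation at two points near \<open>x\<close>;
  continuity transfers the equality to \<open>x\<close>.\<close>

lemma hessian_commute:
  assumes f: "n_times_cont_diff_on 2 S f" and S: "open S" "x \<in> S"
  shows "hessian f x u v = hessian f x v u"
proof (rule ccontr)
  assume ne: "hessian f x u v \<noteq> hessian f x v u"
  \<comment> \<open>Half the gap: no number can be strictly within \<open>e\<close> of both
    values.\<close>
  define e where "e = \<bar>hessian f x u v - hessian f x v u\<bar> / 2"
  have e: "e > 0" using ne by (simp add: e_def)
  have near: "\<exists>d>0. \<forall>p. dist p x < d \<longrightarrow> dist (hessian f p a b) (hessian f x a b) < e" for a b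
  proof -
    have "isCont (\<lambda>p. hessian f p a b) x"
      using n_times_cont_diff_on_2D(3)[OF f] S continuous_on_eq_continuous_at by blast
    then show ?thesis using e by (auto simp: continuous_at_eps_delta)
  qed
  obtain d1 where d1: "d1 > 0" "\<And>p. dist p x < d1 \<Longrightarrow> dist (hessian f p u v) (hessian f x u v) < e"
    using near by blast
  obtain d2 where d2: "d2 > 0" "\<And>p. dist p x < d2 \<Longrightarrow> dist (hessian f p v u) (hessian f x v u) < e"
    using near by blast
  obtain d3 where d3: "d3 > 0" "ball x d3 \<subseteq> S"
    using S open_contains_ball by blast
  define d where "d = min d1 (min d2 d3)"
  have d: "d > 0" "d \<le> d1" "d \<le> d2" using d1 d2 d3 by (auto simp: d_def)
  have fd: "n_times_cont_diff_on 2 (ball x d) f"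
    by (rule n_times_cont_diff_on_subset[OF f]) (use d3 in \<open>auto simp: d_def\<close>)
  \<comment> \<open>The summand 1 keeps the denominator positive when \<open>u = v = 0\<close> and
    makes the bound \<open>s * (norm u + norm v) < d\<close> strict.\<close>
  define s where "s = d / (norm u + norm v + 1)"
  have pos: "norm u + norm v + 1 > 0" by (smt (verit) norm_ge_zero)
  have s: "s > 0" "s * (norm u + norm v) < d"
    using d pos by (auto simp: s_def field_simps)
  then have s': "s * (norm v + norm u) < d" by (simp add: add.commute)
  obtain p where p: "norm (p - x) \<le> s * (norm u + norm v)"
    "f (x + s *\<^sub>R u + s *\<^sub>R v) - f (x + s *\<^sub>R u) - f (x + s *\<^sub>R v) + f x = s * (s * hessian f p v u)"
    using second_difference_eq_hessian[OF fd s] .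
  obtain q where q: "norm (q - x) \<le> s * (norm v + norm u)"
    "f (x + s *\<^sub>R v + s *\<^sub>R u) - f (x + s *\<^sub>R v) - f (x + s *\<^sub>R u) + f x = s * (s * hessian f q u v)"
    using second_difference_eq_hessian[OF fd s(1) s'] .
  have "x + s *\<^sub>R u + s *\<^sub>R v = x + s *\<^sub>R v + s *\<^sub>R u" by simp
  then have "s * (s * hessian f p v u) = s * (s * hessian f q u v)"
    using p(2) q(2) by (simp only:)
  then have "hessian f p v u = hessian f q u v" using s by simp
  moreover have "dist p x < d2" "dist q x < d1"
    using p(1) q(1) s s' d by (auto simp: dist_norm)
  ultimately have "\<bar>hessian f p v u - hessian f x u v\<bar> < e" "\<bar>hessian f p v u - hessian f x v u\<bar> < e"
    using d1(2)[of q] d2(2)[of p] by (auto simp: dist_real_def)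
  then show False
    unfolding e_def by argo
qed

lemma hessian_linear_left:
  assumes "n_times_cont_diff_on 2 S f" "x \<in> S"
  shows "linear (\<lambda>u. hessian f x u v)"
  using has_derivative_linear[OF hessian_works[OF assms]] .

lemma hessian_add_left:
  assumes "n_times_cont_diff_on 2 S f" "x \<in> S"
  shows "hessian f x (u + u') v = hessian f x u v + hessian f x u' v"
  using hessian_linear_left[OF assms] by (rule linear_add)

text \<open>Splitting the first direction into components produces terms on
  \<open>(0, snd a)\<close> and \<open>(0, snd b)\<close> only, which cancel by symmetry. This
  reduces the exterior derivative of \<open>Theta_plus\<close> to mixed derivatives.\<close>

lemma hessian_antisymmetrization_snd:
  fixes f :: "'a::euclidean_space \<times> 'a \<Rightarrow> real"
  assumes f: "n_times_cont_diff_on 2 S f" and S: "open S" "x \<in> S"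
  shows "hessian f x a (0, snd b) - hessian f x b (0, snd a)
    = hessian f x (fst a, 0) (0, snd b) - hessian f x (fst b, 0) (0, snd a)"
  using hessian_add_left[OF f S(2), of "(fst a, 0)" "(0, snd a)" "(0, snd b)"]
    hessian_add_left[OF f S(2), of "(fst b, 0)" "(0, snd b)" "(0, snd a)"]
    hessian_commute[OF f S, of "(0, snd a)" "(0, snd b)"]
  by simp

section \<open>Partial and mixed second derivatives\<close>

lemma has_derivative_slice_snd:
  fixes f :: "'a::euclidean_space \<times> 'b::euclidean_space \<Rightarrow> real"
  assumes "n_times_cont_diff_on 2 S f" "(x, y) \<in> S"
  shows "((\<lambda>y. f (x, y)) has_derivative (\<lambda>v. frechet_derivative f (at (x, y)) (0, v))) (at y)"
proof (rule has_derivative_compose[of "\<lambda>y. (x, y)"])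
  show "((\<lambda>y. (x, y)) has_derivative (\<lambda>v. (0, v))) (at y)"
    by (auto intro!: derivative_eq_intros)
  show "(f has_derivative frechet_derivative f (at (x, y))) (at (x, y))"
    using n_times_cont_diff_on_2D(1)[OF assms] by (simp add: frechet_derivative_works)
qed

lemma has_derivative_slice_fst:
  fixes f :: "'a::euclidean_space \<times> 'b::euclidean_space \<Rightarrow> real"
  assumes "n_times_cont_diff_on 2 S f" "(x, y) \<in> S"
  shows "((\<lambda>x. f (x, y)) has_derivative (\<lambda>v. frechet_derivative f (at (x, y)) (v, 0))) (at x)"
proof (rule has_derivative_compose[of "\<lambda>x. (x, y)"])
  show "((\<lambda>x. (x, y)) has_derivative (\<lambda>v. (v, 0))) (at x)"
    by (auto intro!: derivative_eq_intros)
  show "(f has_derivative frechet_derivative f (at (x, y))) (at (x, y))"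
    using n_times_cont_diff_on_2D(1)[OF assms] by (simp add: frechet_derivative_works)
qed

text \<open>
  Unlike the full Hessian, its mixed part is tensorial: with \<open>y\<close> fixed, differentiating in
  the second argument and then in the first, no second derivative of the coordinate changes appears.
\<close>

lemma mixed_hessian_coordinate_change:
  fixes f f' :: "'a::euclidean_space \<times> 'a \<Rightarrow> real"
  assumes f: "n_times_cont_diff_on 2 S f" and S: "open S" "(x, y) \<in> S"
    and f': "n_times_cont_diff_on 2 S' f'"
    and T: "\<And>x y. (x, y) \<in> S \<Longrightarrow> (\<sigma> x, \<tau> y) \<in> S' \<and> f (x, y) = f' (\<sigma> x, \<tau> y)"
    and \<sigma>: "(\<sigma> has_derivative \<sigma>') (at x)" and \<tau>: "(\<tau> has_derivative \<tau>') (at y)"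
  shows "hessian f (x, y) (u, 0) (0, v) = hessian f' (\<sigma> x, \<tau> y) (\<sigma>' u, 0) (0, \<tau>' v)"
proof -
  have opx: "open ((\<lambda>x. (x, y)) -` S)" and opy: "open ((\<lambda>y. (x, y)) -` S)" for x
    using S(1) by (auto intro!: open_vimage continuous_intros)
  \<comment> \<open>Only \<tau> is differentiated here, at the fixed point \<open>y\<close>, so
    \<open>\<tau>' v\<close> stays constant while the first argument runs through the open slice;
    \<sigma> is differentiated afterwards.\<close>
  have eq: "frechet_derivative f (at (x, y)) (0, v) = frechet_derivative f' (at (\<sigma> x, \<tau> y)) (0, \<tau>' v)"
    if "(x, y) \<in> S" for x
  proof -
    have "((\<lambda>y. f' (\<sigma> x, \<tau> y)) has_derivative
        (\<lambda>v. frechet_derivative f' (at (\<sigma> x, \<tau> y)) (0, \<tau>' v))) (at y)"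
      using has_derivative_compose[OF \<tau> has_derivative_slice_snd[OF f']] T[OF that] by blast
    then have "((\<lambda>y. f (x, y)) has_derivative
        (\<lambda>v. frechet_derivative f' (at (\<sigma> x, \<tau> y)) (0, \<tau>' v))) (at y)"
      by (rule has_derivative_transform_within_open[OF _ opy[of x]]) (use that T in auto)
    then show ?thesis
      using has_derivative_unique_apply[OF has_derivative_slice_snd[OF f that]] by blast
  qed
  have "((\<lambda>x. frechet_derivative f' (at (\<sigma> x, \<tau> y)) (0, \<tau>' v)) has_derivative
      (\<lambda>u. hessian f' (\<sigma> x, \<tau> y) (\<sigma>' u, 0) (0, \<tau>' v))) (at x)"
    by (rule has_derivative_compose[where f = "\<lambda>x. (\<sigma> x, \<tau> y)", OF _ hessian_works[OF f']])
      (use T[OF S(2)] in \<open>auto intro!: derivative_eq_intros \<sigma>\<close>)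
  then have "((\<lambda>x. frechet_derivative f (at (x, y)) (0, v)) has_derivative
      (\<lambda>u. hessian f' (\<sigma> x, \<tau> y) (\<sigma>' u, 0) (0, \<tau>' v))) (at x)"
    by (rule has_derivative_transform_within_open[OF _ opx]) (use S(2) eq in auto)
  moreover have "((\<lambda>x. frechet_derivative f (at (x, y)) (0, v)) has_derivative
      (\<lambda>u. hessian f (x, y) (u, 0) (0, v))) (at x)"
    by (rule has_derivative_compose[where f = "\<lambda>x. (x, y)", OF _ hessian_works[OF f S(2)]])
      (auto intro!: derivative_eq_intros)
  ultimately show ?thesis
    by (rule has_derivative_unique_apply[symmetric])
qed

text \<open>
  Differentiate the Euler-Lagrange equation in direction \<open>a\<close>, pair it with the variation in
  direction \<open>b\<close>, and antisymmetrize: the pure second partial derivatives drop out.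
\<close>

lemma discrete_Euler_Lagrange_mixed_hessian:
  fixes f g :: "'a::euclidean_space \<times> 'a \<Rightarrow> real"
    and y0 y1 y2 :: "'b::euclidean_space \<Rightarrow> 'a"
  assumes f: "n_times_cont_diff_on 2 S f" and S: "open S" "(y0 x, y1 x) \<in> S"
    and g: "n_times_cont_diff_on 2 T g" and T: "open T" "(y1 x, y2 x) \<in> T"
    and y0: "(y0 has_derivative Y0) (at x)" and y1: "(y1 has_derivative Y1) (at x)"
    and y2: "(y2 has_derivative Y2) (at x)"
    and U: "open U" "x \<in> U"
    and EL: "\<And>x w. x \<in> U \<Longrightarrow> frechet_derivative g (at (y1 x, y2 x)) (w, 0)
      + frechet_derivative f (at (y0 x, y1 x)) (0, w) = 0"
  shows "hessian f (y0 x, y1 x) (Y0 a, 0) (0, Y1 b) - hessian f (y0 x, y1 x) (Y0 b, 0) (0, Y1 a)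
    = hessian g (y1 x, y2 x) (Y1 a, 0) (0, Y2 b) - hessian g (y1 x, y2 x) (Y1 b, 0) (0, Y2 a)"
proof -
  \<comment> \<open>The left side of the equation vanishes identically on \<open>U\<close>, so its
    derivative at \<open>x\<close> is zero. As \<open>w\<close> is a constant vector, only first
    derivatives of the curves \<open>y0\<close>, \<open>y1\<close>, \<open>y2\<close>
    appear.\<close>
  have *: "hessian g (y1 x, y2 x) (Y1 a, Y2 a) (w, 0) + hessian f (y0 x, y1 x) (Y0 a, Y1 a) (0, w) = 0"
    for a w
  proof -
    have "((\<lambda>x. frechet_derivative g (at (y1 x, y2 x)) (w, 0)
        + frechet_derivative f (at (y0 x, y1 x)) (0, w)) has_derivative
      (\<lambda>a. hessian g (y1 x, y2 x) (Y1 a, Y2 a) (w, 0) + hessian f (y0 x, y1 x) (Y0 a, Y1 a) (0, w))) (at x)"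
      by (intro has_derivative_add
          has_derivative_compose[OF has_derivative_Pair[OF y1 y2] hessian_works[OF g T(2)]]
          has_derivative_compose[OF has_derivative_Pair[OF y0 y1] hessian_works[OF f S(2)]])
    then have "((\<lambda>x. 0) has_derivative
      (\<lambda>a. hessian g (y1 x, y2 x) (Y1 a, Y2 a) (w, 0) + hessian f (y0 x, y1 x) (Y0 a, Y1 a) (0, w))) (at x)"
      by (rule has_derivative_transform_within_open[OF _ U]) (use EL in auto)
    then show ?thesis
      using has_derivative_unique_apply[OF has_derivative_const] by fastforce
  qed
  have split_f: "hessian f (y0 x, y1 x) (u, v) w
    = hessian f (y0 x, y1 x) (u, 0) w + hessian f (y0 x, y1 x) (0, v) w" for u v w
    using hessian_add_left[OF f S(2), of "(u, 0)" "(0, v)"] by simp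
  have split_g: "hessian g (y1 x, y2 x) (u, v) w
    = hessian g (y1 x, y2 x) (u, 0) w + hessian g (y1 x, y2 x) (0, v) w" for u v w
    using hessian_add_left[OF g T(2), of "(u, 0)" "(0, v)"] by simp
  \<comment> \<open>The choices \<open>w = Y1 b\<close> along \<open>a\<close> and
    \<open>w = Y1 a\<close> along \<open>b\<close> are subtracted. Symmetry removes the terms
    pairing \<open>Y1 a\<close> with \<open>Y1 b\<close> and puts the remaining terms of
    \<open>g\<close> into mixed form.\<close>
  show ?thesis
    using *[of a "Y1 b"] *[of b "Y1 a"]
      split_f[of "Y0 a" "Y1 a" "(0, Y1 b)"] split_f[of "Y0 b" "Y1 b" "(0, Y1 a)"]
      split_g[of "Y1 a" "Y2 a" "(Y1 b, 0)"] split_g[of "Y1 b" "Y2 b" "(Y1 a, 0)"]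
      hessian_commute[OF f S, of "(0, Y1 a)" "(0, Y1 b)"]
      hessian_commute[OF g T, of "(Y1 a, 0)" "(Y1 b, 0)"]
      hessian_commute[OF g T, of "(0, Y2 a)" "(Y1 b, 0)"]
      hessian_commute[OF g T, of "(0, Y2 b)" "(Y1 a, 0)"]
    by linarith
qed

section \<open>Differentiable atlases\<close>

lemma tangent_spaceD:
  assumes "v \<in> tangent_space M p" "c \<in> charts_at M p" "d \<in> charts_at M p"
  shows "v d = frechet_derivative (transition c d) (at (snd c p)) (v c)"
  using assms unfolding tangent_space_def by blast

text \<open>
  What the argument needs of a smooth manifold, in a form inherited by products without
  discussing homeomorphisms.
\<close>

definition differentiable_atlas :: "('q, 'e::euclidean_space) mfd \<Rightarrow> bool" where
  "differentiable_atlas M \<longleftrightarrow>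
     (\<forall>c\<in>mfd_atlas M. openin (mfd_top M) (fst c) \<and> inj_on (snd c) (fst c) \<and>
        (\<forall>U. openin (mfd_top M) U \<longrightarrow> open (snd c ` (fst c \<inter> U)))) \<and>
     (\<forall>p. \<forall>c\<in>charts_at M p. \<forall>d\<in>charts_at M p. transition c d differentiable at (snd c p)) \<and>
     (\<forall>p\<in>points M. charts_at M p \<noteq> {})"

lemma n_times_cont_diff_on_1D:
  "n_times_cont_diff_on 1 S f \<Longrightarrow> x \<in> S \<Longrightarrow> f differentiable at x"
  by (simp add: One_nat_def)

lemma C_class_onD:
  "C_class_on r S f \<Longrightarrow> enat n \<le> r \<Longrightarrow> n_times_cont_diff_on n S f"
  by (simp add: C_class_on_def)

text \<open>A chart is an open map onto a range that is itself open, so images open in the range are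
  open in the model space. Transition maps are of class 1, hence differentiable.\<close>

lemma differentiable_atlas_if_smooth_manifold:
  assumes M: "smooth_manifold M"
  shows "differentiable_atlas M"
proof -
  have chart: "openin (mfd_top M) (fst c)" "inj_on (snd c) (fst c)"
    "openin (mfd_top M) U \<Longrightarrow> open (snd c ` (fst c \<inter> U))" if c: "c \<in> mfd_atlas M" for c U
  proof -
    have c': "is_chart (mfd_top M) c" using M c by (simp add: smooth_manifold_def)
    then show op: "openin (mfd_top M) (fst c)" by (simp add: is_chart_def)
    have hom: "homeomorphic_map (subtopology (mfd_top M) (fst c)) (top_of_set (snd c ` fst c)) (snd c)"
      and im: "open (snd c ` fst c)"
      using c' by (simp_all add: is_chart_def)
    have sub: "topspace (mfd_top M) \<inter> fst c = fst c" using openin_subset[OF op] by blast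
    show "inj_on (snd c) (fst c)"
      using homeomorphic_imp_injective_map[OF hom] sub by (simp add: topspace_subtopology)
    assume U: "openin (mfd_top M) U"
    have "openin (subtopology (mfd_top M) (fst c)) (fst c \<inter> U)"
      using U openin_subtopology_Int2 by blast
    then have "openin (top_of_set (snd c ` fst c)) (snd c ` (fst c \<inter> U))"
      using homeomorphic_imp_open_map[OF hom] by (simp add: open_map_def)
    then show "open (snd c ` (fst c \<inter> U))"
      using im openin_open_eq by blast
  qed
  have "transition c d differentiable at (snd c p)"
    if "c \<in> charts_at M p" "d \<in> charts_at M p" for c d p
  proof -
    have "C_class_on \<infinity> (snd c ` (fst c \<inter> fst d)) (transition c d)"
      using M that by (simp add: smooth_manifold_def charts_at_def)
    then have "n_times_cont_diff_on 1 (snd c ` (fst c \<inter> fst d)) (transition c d)"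
      by (rule C_class_onD) simp
    then show ?thesis
      by (rule n_times_cont_diff_on_1D) (use that in \<open>auto simp: charts_at_def\<close>)
  qed
  moreover have "charts_at M p \<noteq> {}" if "p \<in> points M" for p
  proof -
    have "p \<in> (\<Union>c\<in>mfd_atlas M. fst c)" using M that by (simp add: smooth_manifold_def)
    then show ?thesis by (auto simp: charts_at_def simp del: split_paired_Ex)
  qed
  ultimately show ?thesis
    using chart by (simp add: differentiable_atlas_def)
qed

section \<open>Charts, transition maps and tangent vectors of a fixed atlas\<close>

context
  fixes M :: "('q, 'e::euclidean_space) mfd"
  assumes M: "differentiable_atlas M"
begin

lemma chart_inv_apply: "c \<in> charts_at M p \<Longrightarrow> chart_inv c (snd c p) = p"
  using M by (simp add: differentiable_atlas_def charts_at_def chart_inv_def)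

lemma charts_at_chart_inv:
  assumes "c \<in> mfd_atlas M" "x \<in> snd c ` fst c"
  shows "c \<in> charts_at M (chart_inv c x)" "snd c (chart_inv c x) = x"
  using assms by (auto simp: charts_at_def chart_inv_def inv_into_into f_inv_into_f)

lemma open_chart_image:
  "c \<in> mfd_atlas M \<Longrightarrow> openin (mfd_top M) U \<Longrightarrow> open (snd c ` (fst c \<inter> U))"
  using M by (simp add: differentiable_atlas_def)

lemma openin_chart: "c \<in> mfd_atlas M \<Longrightarrow> openin (mfd_top M) (fst c)"
  using M by (simp add: differentiable_atlas_def)

lemma open_chart_range: "c \<in> mfd_atlas M \<Longrightarrow> open (snd c ` fst c)"
  using open_chart_image[OF _ openin_chart, of c c] by simp

lemma open_chart_vimage:
  assumes "c \<in> mfd_atlas M" "continuous_map (mfd_top M) X F" "openin X U"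
  shows "open (snd c ` (fst c \<inter> F -` U))"
proof -
  have "fst c \<inter> F -` U = fst c \<inter> {x \<in> points M. F x \<in> U}"
    using openin_subset[OF openin_chart[OF assms(1)]] by blast
  then show ?thesis
    using open_chart_image[OF assms(1) openin_continuous_map_preimage[OF assms(2,3)]] by simp
qed

lemma some_chart_at: "p \<in> points M \<Longrightarrow> some_chart_at M p \<in> charts_at M p"
  using M unfolding some_chart_at_def differentiable_atlas_def by (metis ex_in_conv someI)

lemma charts_at_in_points: "c \<in> charts_at M p \<Longrightarrow> p \<in> points M"
  using openin_subset[OF openin_chart, of c] by (auto simp: charts_at_def)

lemma transition_works:
  assumes "c \<in> charts_at M p" "d \<in> charts_at M p"
  shows "(transition c d has_derivative frechet_derivative (transition c d) (at (snd c p))) (at (snd c p))"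
  using M assms by (simp add: differentiable_atlas_def frechet_derivative_works[symmetric])

lemma transition_apply: "c \<in> charts_at M p \<Longrightarrow> transition c d (snd c p) = snd d p"
  by (simp add: transition_def chart_inv_apply)

text \<open>Chain rule for \<open>F \<circ> chart_inv d\<close> after \<open>transition c d\<close>.
  The composite agrees with \<open>F \<circ> chart_inv c\<close> on the image of the overlap of the
  two domains, an open set, which suffices for the derivative.\<close>

lemma has_derivative_change_chart:
  assumes c: "c \<in> charts_at M p" and d: "d \<in> charts_at M p"
    and F: "((F \<circ> chart_inv d) has_derivative D) (at (snd d p))"
  shows "((F \<circ> chart_inv c) has_derivative
    (\<lambda>v. D (frechet_derivative (transition c d) (at (snd c p)) v))) (at (snd c p))"
proof -
  have "((\<lambda>x. (F \<circ> chart_inv d) (transition c d x)) has_derivative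
    (\<lambda>v. D (frechet_derivative (transition c d) (at (snd c p)) v))) (at (snd c p))"
    by (rule has_derivative_compose[OF transition_works[OF c d]]) (simp only: transition_apply[OF c] F)
  moreover have "open (snd c ` (fst c \<inter> fst d))" "snd c p \<in> snd c ` (fst c \<inter> fst d)"
    using c d open_chart_image openin_chart by (auto simp: charts_at_def)
  moreover have "(F \<circ> chart_inv d) (transition c d x) = (F \<circ> chart_inv c) x"
    if "x \<in> snd c ` (fst c \<inter> fst d)" for x
  proof -
    from that obtain q where q: "x = snd c q" "q \<in> fst c" "q \<in> fst d" by blast
    then have "c \<in> charts_at M q" "d \<in> charts_at M q" using c d by (auto simp: charts_at_def)
    with q show ?thesis by (simp add: transition_apply chart_inv_apply)
  qed
  ultimately show ?thesis
    by (rule has_derivative_transform_within_open)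
qed

text \<open>The cocycle rule is the change of chart applied to the coordinate map of
  \<open>e\<close>. It is what makes \<open>tvec_of_coord\<close> a tangent vector.\<close>

lemma frechet_derivative_transition_trans:
  assumes "c \<in> charts_at M p" "d \<in> charts_at M p" "e \<in> charts_at M p"
  shows "frechet_derivative (transition c e) (at (snd c p)) v
    = frechet_derivative (transition d e) (at (snd d p))
        (frechet_derivative (transition c d) (at (snd c p)) v)"
proof -
  have "((snd e \<circ> chart_inv d) has_derivative frechet_derivative (transition d e) (at (snd d p))) (at (snd d p))"
    using transition_works[OF assms(2,3)] by (simp add: transition_def)
  from has_derivative_change_chart[OF assms(1,2) this]
  show ?thesis
    unfolding transition_def[of c e, symmetric]
    by (rule has_derivative_unique_apply[OF transition_works[OF assms(1,3)]])
qed

lemma frechet_derivative_transition_self: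
  assumes c: "c \<in> charts_at M p"
  shows "frechet_derivative (transition c c) (at (snd c p)) v = v"
proof -
  have "(transition c c has_derivative (\<lambda>v. v)) (at (snd c p))"
  proof (rule has_derivative_transform_within_open[OF has_derivative_ident])
    show "open (snd c ` fst c)" "snd c p \<in> snd c ` fst c"
      using c open_chart_range by (auto simp: charts_at_def)
    show "x = transition c c x" if "x \<in> snd c ` fst c" for x
      using charts_at_chart_inv that c by (simp add: transition_def charts_at_def)
  qed
  then show ?thesis
    using has_derivative_unique_apply[OF transition_works[OF c c]] by blast
qed

lemma tvec_of_coord_self: "c \<in> charts_at M p \<Longrightarrow> tvec_of_coord M c p v c = v"
  by (simp add: tvec_of_coord_def frechet_derivative_transition_self)

lemma tvec_of_coord_in_tangent_space:
  assumes "c \<in> charts_at M p"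
  shows "tvec_of_coord M c p v \<in> tangent_space M p"
  unfolding tangent_space_def tvec_of_coord_def
  by (intro CollectI conjI ballI allI impI)
    (simp only: if_True, rule frechet_derivative_transition_trans[OF assms], assumption+, simp)

text \<open>This removes the arbitrary choice \<open>some_chart_at\<close> from the definition: the
  transformation law of \<open>v\<close> matches the chain rule for the change from the chosen chart
  to \<open>c\<close>.\<close>

lemma push_forward_in_chart:
  assumes c: "c \<in> charts_at M p" and v: "v \<in> tangent_space M p" and d: "d \<in> charts_at N (F p)"
    and F: "((snd d \<circ> F \<circ> chart_inv c) has_derivative D) (at (snd c p))"
  shows "push_forward M N F p v d = D (v c)"
proof -
  define c0 where "c0 = some_chart_at M p"
  have c0: "c0 \<in> charts_at M p"
    using some_chart_at[OF charts_at_in_points[OF c]] by (simp add: c0_def)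
  have "v c = frechet_derivative (transition c0 c) (at (snd c0 p)) (v c0)"
    by (rule tangent_spaceD[OF v c0 c])
  moreover have "D (frechet_derivative (transition c0 c) (at (snd c0 p)) (v c0))
      = frechet_derivative (snd d \<circ> F \<circ> chart_inv c0) (at (snd c0 p)) (v c0)"
    using fun_cong[OF frechet_derivative_at[OF has_derivative_change_chart[OF c0 c F]]] .
  ultimately show ?thesis
    using d by (simp only: push_forward_def Let_def c0_def[symmetric] if_True)
qed

lemma differential_in_chart:
  assumes "c \<in> charts_at M p" "v \<in> tangent_space M p"
    and "((f \<circ> chart_inv c) has_derivative D) (at (snd c p))"
  shows "differential M f p v = D (v c)"
  unfolding differential_def
  by (rule push_forward_in_chart[OF assms(1,2)])
    (use assms(3) in \<open>simp_all add: charts_at_def real_mfd_def\<close>)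

end

section \<open>Differentiable maps\<close>

text \<open>Continuity makes preimages of chart domains open, so that near each point the map can be
  followed in one fixed pair of charts.\<close>

definition differentiable_map ::
  "('q, 'e::euclidean_space) mfd \<Rightarrow> ('p, 'f::euclidean_space) mfd \<Rightarrow> ('q \<Rightarrow> 'p) \<Rightarrow> bool" where
  "differentiable_map M N F \<longleftrightarrow> continuous_map (mfd_top M) (mfd_top N) F \<and>
     (\<forall>p. \<forall>c\<in>charts_at M p. \<forall>d\<in>charts_at N (F p).
        (snd d \<circ> F \<circ> chart_inv c) differentiable at (snd c p))"

lemma differentiable_map_works:
  assumes "differentiable_map M N F" "c \<in> charts_at M p" "d \<in> charts_at N (F p)"
  shows "((snd d \<circ> F \<circ> chart_inv c) has_derivative
    frechet_derivative (snd d \<circ> F \<circ> chart_inv c) (at (snd c p))) (at (snd c p))"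
  using assms by (simp add: differentiable_map_def frechet_derivative_works[symmetric])

lemma differentiable_map_if_C_class_map:
  assumes F: "C_class_map r M N F" and r: "1 \<le> r"
  shows "differentiable_map M N F"
proof -
  have "(snd d \<circ> F \<circ> chart_inv c) differentiable at (snd c p)"
    if "c \<in> charts_at M p" "d \<in> charts_at N (F p)" for p c d
  proof -
    have "C_class_on r (snd c ` (fst c \<inter> F -` fst d)) (snd d \<circ> F \<circ> chart_inv c)"
      using F that by (simp add: C_class_map_def charts_at_def)
    then have "n_times_cont_diff_on 1 (snd c ` (fst c \<inter> F -` fst d)) (snd d \<circ> F \<circ> chart_inv c)"
      by (rule C_class_onD) (use r in \<open>simp add: one_enat_def\<close>)
    then show ?thesis
      by (rule n_times_cont_diff_on_1D) (use that in \<open>auto simp: charts_at_def\<close>)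
  qed
  then show ?thesis
    using F by (simp add: differentiable_map_def C_class_map_def)
qed

text \<open>All components come from the single coordinate vector of \<open>v\<close> in the chosen
  chart, so compatibility between target charts \<open>d\<close> and \<open>e\<close> is the chain
  rule for \<open>transition d e\<close> after \<open>F\<close>.\<close>

lemma push_forward_in_tangent_space:
  assumes M: "differentiable_atlas M" and N: "differentiable_atlas N"
    and F: "differentiable_map M N F" and p: "p \<in> points M"
  shows "push_forward M N F p v \<in> tangent_space N (F p)"
proof -
  define c where "c = some_chart_at M p"
  have c: "c \<in> charts_at M p"
    unfolding c_def by (rule some_chart_at[OF M p])
  have *: "frechet_derivative (snd e \<circ> F \<circ> chart_inv c) (at (snd c p)) (v c)
    = frechet_derivative (transition d e) (at (snd d (F p)))
        (frechet_derivative (snd d \<circ> F \<circ> chart_inv c) (at (snd c p)) (v c))"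
    if d: "d \<in> charts_at N (F p)" and e: "e \<in> charts_at N (F p)" for d e
  proof -
    let ?S = "snd c ` (fst c \<inter> F -` fst d)"
    have "((\<lambda>x. transition d e ((snd d \<circ> F \<circ> chart_inv c) x)) has_derivative
       (\<lambda>v. frechet_derivative (transition d e) (at (snd d (F p)))
        (frechet_derivative (snd d \<circ> F \<circ> chart_inv c) (at (snd c p)) v))) (at (snd c p))"
      by (rule has_derivative_compose[OF differentiable_map_works[OF F c d]])
        (use transition_works[OF N d e] chart_inv_apply[OF M c] in simp)
    moreover have "open ?S" "snd c p \<in> ?S"
      using c d F open_chart_vimage[OF M _ _ openin_chart[OF N]]
      by (auto simp: charts_at_def differentiable_map_def)
    moreover have "transition d e ((snd d \<circ> F \<circ> chart_inv c) x) = (snd e \<circ> F \<circ> chart_inv c) x"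
      if "x \<in> ?S" for x
    proof -
      from that obtain q where q: "x = snd c q" "q \<in> fst c" "F q \<in> fst d" by blast
      then have "c \<in> charts_at M q" "d \<in> charts_at N (F q)" using c d by (auto simp: charts_at_def)
      with q show ?thesis by (simp add: transition_apply[OF N] chart_inv_apply[OF M])
    qed
    ultimately have "((snd e \<circ> F \<circ> chart_inv c) has_derivative
       (\<lambda>v. frechet_derivative (transition d e) (at (snd d (F p)))
        (frechet_derivative (snd d \<circ> F \<circ> chart_inv c) (at (snd c p)) v))) (at (snd c p))"
      by (rule has_derivative_transform_within_open)
    then show ?thesis
      using has_derivative_unique_apply[OF differentiable_map_works[OF F c e]] by blast
  qed
  show ?thesis
    unfolding tangent_space_def push_forward_def Let_def c_def[symmetric]
    by (intro CollectI conjI ballI allI impI) (simp only: if_True, rule *, assumption+, simp)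
qed

section \<open>Product manifolds\<close>

definition prod_chart :: "('q, 'e) chart \<Rightarrow> ('p, 'f) chart \<Rightarrow> ('q \<times> 'p, 'e \<times> 'f) chart" where
  "prod_chart c d = (fst c \<times> fst d, map_prod (snd c) (snd d))"

lemma mfd_top_prod [simp]: "mfd_top (prod_mfd M N) = prod_topology (mfd_top M) (mfd_top N)"
  by (simp add: prod_mfd_def)

lemma mfd_atlas_prod:
  "mfd_atlas (prod_mfd M N) = {prod_chart c d |c d. c \<in> mfd_atlas M \<and> d \<in> mfd_atlas N}"
  by (simp add: prod_mfd_def prod_chart_def)

lemma charts_at_prodI:
  assumes "c \<in> charts_at M (fst z)" "d \<in> charts_at N (snd z)"
  shows "prod_chart c d \<in> charts_at (prod_mfd M N) z"
proof -
  have "z \<in> fst (prod_chart c d)"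
    using assms by (simp add: charts_at_def prod_chart_def mem_Times_iff)
  then show ?thesis
    using assms unfolding charts_at_def mfd_atlas_prod by blast
qed

lemma charts_at_prodE:
  assumes "C \<in> charts_at (prod_mfd M N) z"
  obtains c d where "C = prod_chart c d" "c \<in> charts_at M (fst z)" "d \<in> charts_at N (snd z)"
proof -
  obtain c d where C: "C = prod_chart c d" and "c \<in> mfd_atlas M" "d \<in> mfd_atlas N"
    using assms unfolding charts_at_def mfd_atlas_prod by blast
  moreover have "fst z \<in> fst c" "snd z \<in> fst d"
    using assms by (simp_all add: C charts_at_def prod_chart_def mem_Times_iff)
  ultimately show ?thesis
    by (intro that[of c d]) (simp_all add: charts_at_def)
qed

lemma snd_prod_chart [simp]: "snd (prod_chart c d) (p, q) = (snd c p, snd d q)"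
  by (simp add: prod_chart_def)

lemma prod_chart_range: "snd (prod_chart c d) ` fst (prod_chart c d) = snd c ` fst c \<times> snd d ` fst d"
  by (auto simp: prod_chart_def)

lemma chart_inv_prod_chart:
  assumes M: "differentiable_atlas M" and N: "differentiable_atlas N"
    and "c \<in> mfd_atlas M" "d \<in> mfd_atlas N" "x \<in> snd c ` fst c" "y \<in> snd d ` fst d"
  shows "chart_inv (prod_chart c d) (x, y) = (chart_inv c x, chart_inv d y)"
proof -
  have "inj_on (snd c) (fst c)" "inj_on (snd d) (fst d)"
    using assms by (simp_all add: differentiable_atlas_def)
  then have "inj_on (map_prod (snd c) (snd d)) (fst c \<times> fst d)"
    by (rule map_prod_inj_on)
  then show ?thesis
    unfolding chart_inv_def prod_chart_def fst_conv snd_conv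
    by (rule inv_into_f_eq) (use assms in \<open>auto simp: inv_into_into f_inv_into_f\<close>)
qed

text \<open>An open set of the product need not be a box, but every point of it lies in an open box
  inside it, and the chart image of a box is a product of two open chart images.\<close>

lemma open_prod_chart_image:
  assumes M: "differentiable_atlas M" and N: "differentiable_atlas N"
    and c: "c \<in> mfd_atlas M" and d: "d \<in> mfd_atlas N"
    and U: "openin (prod_topology (mfd_top M) (mfd_top N)) U"
  shows "open (snd (prod_chart c d) ` (fst (prod_chart c d) \<inter> U))"
proof (subst open_subopen, rule ballI)
  fix z assume "z \<in> snd (prod_chart c d) ` (fst (prod_chart c d) \<inter> U)"
  then obtain p q where z: "z = (snd c p, snd d q)" "p \<in> fst c" "q \<in> fst d" "(p, q) \<in> U"
    by (auto simp: prod_chart_def)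
  obtain V W where VW: "openin (mfd_top M) V" "openin (mfd_top N) W" "p \<in> V" "q \<in> W" "V \<times> W \<subseteq> U"
    using U z(4) unfolding openin_prod_topology_alt by meson
  have "open (snd c ` (fst c \<inter> V) \<times> snd d ` (fst d \<inter> W))"
    by (intro open_Times open_chart_image[OF M c] open_chart_image[OF N d] VW)
  moreover have "z \<in> snd c ` (fst c \<inter> V) \<times> snd d ` (fst d \<inter> W)"
    using z VW by auto
  moreover have "snd c ` (fst c \<inter> V) \<times> snd d ` (fst d \<inter> W)
    \<subseteq> snd (prod_chart c d) ` (fst (prod_chart c d) \<inter> U)"
  proof -
    have "snd c ` (fst c \<inter> V) \<times> snd d ` (fst d \<inter> W)
        = snd (prod_chart c d) ` ((fst c \<inter> V) \<times> (fst d \<inter> W))"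
      by (auto simp: prod_chart_def)
    also have "\<dots> \<subseteq> snd (prod_chart c d) ` (fst (prod_chart c d) \<inter> U)"
      by (rule image_mono) (use VW(5) in \<open>auto simp: prod_chart_def\<close>)
    finally show ?thesis .
  qed
  ultimately show "\<exists>T. open T \<and> z \<in> T \<and> T \<subseteq> snd (prod_chart c d) ` (fst (prod_chart c d) \<inter> U)"
    by blast
qed

text \<open>On the product of the chart ranges the inverse of a product chart splits into the two
  inverses, so the derivative is block diagonal.\<close>

lemma transition_prod_chart_has_derivative:
  assumes M: "differentiable_atlas M" and N: "differentiable_atlas N"
    and c: "c \<in> charts_at M p" "d \<in> charts_at M p" and c': "c' \<in> charts_at N q" "d' \<in> charts_at N q"
  shows "(transition (prod_chart c c') (prod_chart d d') has_derivative
    (\<lambda>v. (frechet_derivative (transition c d) (at (snd c p)) (fst v),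
          frechet_derivative (transition c' d') (at (snd c' q)) (snd v)))) (at (snd c p, snd c' q))"
proof (rule has_derivative_transform_within_open)
  have 1: "((\<lambda>x. transition c d (fst x)) has_derivative
      (\<lambda>v. frechet_derivative (transition c d) (at (snd c p)) (fst v))) (at (snd c p, snd c' q))"
    by (rule has_derivative_compose[of fst]) (auto intro!: derivative_eq_intros transition_works[OF M c])
  have 2: "((\<lambda>x. transition c' d' (snd x)) has_derivative
      (\<lambda>v. frechet_derivative (transition c' d') (at (snd c' q)) (snd v))) (at (snd c p, snd c' q))"
    by (rule has_derivative_compose[of snd]) (auto intro!: derivative_eq_intros transition_works[OF N c'])
  show "((\<lambda>x. (transition c d (fst x), transition c' d' (snd x))) has_derivative
    (\<lambda>v. (frechet_derivative (transition c d) (at (snd c p)) (fst v),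
          frechet_derivative (transition c' d') (at (snd c' q)) (snd v)))) (at (snd c p, snd c' q))"
    by (rule has_derivative_Pair[OF 1 2])
  show "open (snd c ` fst c \<times> snd c' ` fst c')"
    using c c' by (intro open_Times open_chart_range[OF M] open_chart_range[OF N]) (auto simp: charts_at_def)
  show "(snd c p, snd c' q) \<in> snd c ` fst c \<times> snd c' ` fst c'"
    using c c' by (auto simp: charts_at_def)
  show "(transition c d (fst x), transition c' d' (snd x)) = transition (prod_chart c c') (prod_chart d d') x"
    if "x \<in> snd c ` fst c \<times> snd c' ` fst c'" for x
  proof -
    have "chart_inv (prod_chart c c') (fst x, snd x) = (chart_inv c (fst x), chart_inv c' (snd x))"
      by (rule chart_inv_prod_chart[OF M N]) (use that c c' in \<open>auto simp: charts_at_def\<close>)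
    then show ?thesis by (simp add: transition_def)
  qed
qed

lemma differentiable_atlas_prod:
  assumes M: "differentiable_atlas M" and N: "differentiable_atlas N"
  shows "differentiable_atlas (prod_mfd M N)"
proof -
  have chart: "openin (mfd_top (prod_mfd M N)) (fst C) \<and> inj_on (snd C) (fst C) \<and>
      (\<forall>U. openin (mfd_top (prod_mfd M N)) U \<longrightarrow> open (snd C ` (fst C \<inter> U)))"
    if "C \<in> mfd_atlas (prod_mfd M N)" for C
  proof -
    from that obtain c d where C: "C = prod_chart c d" and c: "c \<in> mfd_atlas M" and d: "d \<in> mfd_atlas N"
      unfolding mfd_atlas_prod by blast
    have "inj_on (snd c) (fst c)" "inj_on (snd d) (fst d)"
      using M N c d by (simp_all add: differentiable_atlas_def)
    then show ?thesis
      using openin_chart[OF M c] openin_chart[OF N d] open_prod_chart_image[OF M N c d]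
      by (simp add: C prod_chart_def openin_prod_Times_iff map_prod_inj_on)
  qed
  have trans: "transition C D differentiable at (snd C z)"
    if C: "C \<in> charts_at (prod_mfd M N) z" and D: "D \<in> charts_at (prod_mfd M N) z" for z C D
  proof -
    obtain c c' where c: "C = prod_chart c c'" "c \<in> charts_at M (fst z)" "c' \<in> charts_at N (snd z)"
      using charts_at_prodE[OF C] .
    obtain d d' where d: "D = prod_chart d d'" "d \<in> charts_at M (fst z)" "d' \<in> charts_at N (snd z)"
      using charts_at_prodE[OF D] .
    show ?thesis
      using transition_prod_chart_has_derivative[OF M N c(2) d(2) c(3) d(3)]
      unfolding c(1) d(1) by (cases z) (auto intro: differentiableI)
  qed
  have cover: "charts_at (prod_mfd M N) z \<noteq> {}" if "z \<in> points (prod_mfd M N)" for z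
  proof -
    have "fst z \<in> points M" "snd z \<in> points N"
      using that by (simp_all add: mem_Times_iff)
    then have "prod_chart (some_chart_at M (fst z)) (some_chart_at N (snd z)) \<in> charts_at (prod_mfd M N) z"
      by (intro charts_at_prodI some_chart_at[OF M] some_chart_at[OF N])
    then show ?thesis by blast
  qed
  show ?thesis
    unfolding differentiable_atlas_def using chart trans cover by blast
qed

lemma differentiable_map_Pair:
  assumes F: "differentiable_map M N F" and G: "differentiable_map M K G"
  shows "differentiable_map M (prod_mfd N K) (\<lambda>x. (F x, G x))"
  unfolding differentiable_map_def
proof (intro conjI allI ballI)
  show "continuous_map (mfd_top M) (mfd_top (prod_mfd N K)) (\<lambda>x. (F x, G x))"
    using F G by (simp add: differentiable_map_def continuous_map_pairedI)
  fix p c d assume c: "c \<in> charts_at M p" and "d \<in> charts_at (prod_mfd N K) (F p, G p)"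
  then obtain d1 d2 where d: "d = prod_chart d1 d2" "d1 \<in> charts_at N (F p)" "d2 \<in> charts_at K (G p)"
    by (elim charts_at_prodE) simp
  have eq: "snd d \<circ> (\<lambda>x. (F x, G x)) \<circ> chart_inv c
      = (\<lambda>x. ((snd d1 \<circ> F \<circ> chart_inv c) x, (snd d2 \<circ> G \<circ> chart_inv c) x))"
    by (auto simp: d)
  show "(snd d \<circ> (\<lambda>x. (F x, G x)) \<circ> chart_inv c) differentiable at (snd c p)"
    unfolding eq
    by (rule differentiableI[OF has_derivative_Pair[OF differentiable_map_works[OF F c d(2)]
            differentiable_map_works[OF G c d(3)]]])
qed

lemma has_derivative_snd_in_prod_chart:
  assumes M: "differentiable_atlas M" and N: "differentiable_atlas N"
    and c: "c \<in> charts_at M p" and d: "d \<in> charts_at N q"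
  shows "((snd d \<circ> snd \<circ> chart_inv (prod_chart c d)) has_derivative snd) (at (snd c p, snd d q))"
proof (rule has_derivative_transform_within_open)
  show "(snd has_derivative snd) (at (snd c p, snd d q))"
    by (auto intro!: derivative_eq_intros)
  show "open (snd c ` fst c \<times> snd d ` fst d)"
    using c d by (intro open_Times open_chart_range[OF M] open_chart_range[OF N]) (auto simp: charts_at_def)
  show "(snd c p, snd d q) \<in> snd c ` fst c \<times> snd d ` fst d"
    using c d by (auto simp: charts_at_def)
  show "snd x = (snd d \<circ> snd \<circ> chart_inv (prod_chart c d)) x"
    if "x \<in> snd c ` fst c \<times> snd d ` fst d" for x
  proof -
    have "chart_inv (prod_chart c d) (fst x, snd x) = (chart_inv c (fst x), chart_inv d (snd x))"
      by (rule chart_inv_prod_chart[OF M N]) (use that c d in \<open>auto simp: charts_at_def\<close>)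
    moreover have "snd d (chart_inv d (snd x)) = snd x"
      by (rule charts_at_chart_inv(2)[OF N]) (use that d in \<open>auto simp: charts_at_def\<close>)
    ultimately show ?thesis by simp
  qed
qed

text \<open>If the second factor of the source chart is the target chart \<open>e\<close> itself,
  the projection reads as \<open>snd\<close> in coordinates; a change of chart on the source covers
  the general case.\<close>

lemma differentiable_map_snd:
  assumes M: "differentiable_atlas M" and N: "differentiable_atlas N"
  shows "differentiable_map (prod_mfd M N) N snd"
  unfolding differentiable_map_def
proof (intro conjI allI ballI)
  show "continuous_map (mfd_top (prod_mfd M N)) (mfd_top N) snd"
    by (simp add: continuous_map_snd)
  fix z C e assume "C \<in> charts_at (prod_mfd M N) z" and e: "e \<in> charts_at N (snd z)"
  then obtain c d where C: "C = prod_chart c d" "c \<in> charts_at M (fst z)" "d \<in> charts_at N (snd z)"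
    by (elim charts_at_prodE)
  have E: "prod_chart c e \<in> charts_at (prod_mfd M N) z"
    by (rule charts_at_prodI[OF C(2) e])
  have "((snd e \<circ> snd \<circ> chart_inv (prod_chart c e)) has_derivative snd) (at (snd (prod_chart c e) z))"
    using has_derivative_snd_in_prod_chart[OF M N C(2) e] by (cases z) simp
  from has_derivative_change_chart[OF differentiable_atlas_prod[OF M N] charts_at_prodI[OF C(2,3)] E this]
  show "(snd e \<circ> snd \<circ> chart_inv C) differentiable at (snd C z)"
    unfolding C(1) by (rule differentiableI)
qed

section \<open>Discrete Lagrangians in coordinates\<close>

text \<open>Two charts are allowed because consecutive points of a path may lie far apart. Using the
  inverse of the product chart matches the expression in \<open>C_class_map\<close>.\<close>

definition local_rep ::
  "('q \<Rightarrow> 'q \<Rightarrow> real) \<Rightarrow> ('q, 'e) chart \<Rightarrow> ('q, 'e) chart \<Rightarrow> 'e \<times> 'e \<Rightarrow> real" where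
  "local_rep \<Lambda> c d = (\<lambda>(p, q). \<Lambda> p q) \<circ> chart_inv (prod_chart c d)"

definition C2_lagrangian :: "('q, 'e::euclidean_space) mfd \<Rightarrow> ('q \<Rightarrow> 'q \<Rightarrow> real) \<Rightarrow> bool" where
  "C2_lagrangian Q \<Lambda> \<longleftrightarrow> (\<forall>c\<in>mfd_atlas Q. \<forall>d\<in>mfd_atlas Q.
     n_times_cont_diff_on 2 (snd c ` fst c \<times> snd d ` fst d) (local_rep \<Lambda> c d))"

lemma C2_lagrangian_if_C_class_map:
  assumes \<Lambda>: "C_class_map r (prod_mfd Q Q) real_mfd (\<lambda>(p, q). \<Lambda> p q)" and r: "2 \<le> r"
  shows "C2_lagrangian Q \<Lambda>"
  unfolding C2_lagrangian_def
proof (intro ballI)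
  fix c d assume "c \<in> mfd_atlas Q" "d \<in> mfd_atlas Q"
  then have C: "prod_chart c d \<in> mfd_atlas (prod_mfd Q Q)"
    unfolding mfd_atlas_prod by blast
  have R: "(UNIV, id) \<in> mfd_atlas real_mfd"
    by (simp add: real_mfd_def)
  have "C_class_on r (snd (prod_chart c d) ` (fst (prod_chart c d) \<inter> (\<lambda>(p, q). \<Lambda> p q) -` UNIV))
      (id \<circ> (\<lambda>(p, q). \<Lambda> p q) \<circ> chart_inv (prod_chart c d))"
    using \<Lambda>[unfolded C_class_map_def, THEN conjunct2, rule_format, OF C R] by simp
  then have "C_class_on r (snd c ` fst c \<times> snd d ` fst d) (local_rep \<Lambda> c d)"
    by (simp add: prod_chart_range local_rep_def)
  then show "n_times_cont_diff_on 2 (snd c ` fst c \<times> snd d ` fst d) (local_rep \<Lambda> c d)"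
    by (rule C_class_onD) (use r in \<open>simp add: numeral_eq_enat\<close>)
qed

section \<open>Coordinate expressions of the differentials, the one-form and the symplectic
  form\<close>

context
  fixes Q :: "('q, 'e::euclidean_space) mfd"
  assumes Q: "differentiable_atlas Q"
begin

lemma local_rep_apply:
  assumes "c \<in> charts_at Q p" "d \<in> charts_at Q q"
  shows "local_rep \<Lambda> c d (snd c p, snd d q) = \<Lambda> p q"
  using chart_inv_apply[OF differentiable_atlas_prod[OF Q Q] charts_at_prodI, of c "(p, q)" d] assms
  by (simp add: local_rep_def)

lemma chart_range_prod:
  assumes "c \<in> charts_at Q p" "d \<in> charts_at Q q"
  shows "open (snd c ` fst c \<times> snd d ` fst d)" "(snd c p, snd d q) \<in> snd c ` fst c \<times> snd d ` fst d"
  using assms open_chart_range[OF Q] by (auto simp: charts_at_def intro!: open_Times)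

lemma local_rep_cont_diff:
  assumes "C2_lagrangian Q \<Lambda>" "c \<in> charts_at Q p" "d \<in> charts_at Q q"
  shows "n_times_cont_diff_on 2 (snd c ` fst c \<times> snd d ` fst d) (local_rep \<Lambda> c d)"
  using assms by (simp add: C2_lagrangian_def charts_at_def)

text \<open>Freezing the first argument of the local representative at \<open>snd c p\<close> gives,
  on the range of \<open>d\<close>, the function that \<open>D4\<close> differentiates; the
  differential is therefore a partial derivative.\<close>

lemma D4_in_chart:
  assumes L: "C2_lagrangian Q (L t \<omega>)" and c: "c \<in> charts_at Q p" and d: "d \<in> charts_at Q q"
    and v: "v \<in> tangent_space Q q"
  shows "D4 Q L t \<omega> p q v = frechet_derivative (local_rep (L t \<omega>) c d) (at (snd c p, snd d q)) (0, v d)"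
  unfolding D4_def
proof (rule differential_in_chart[OF Q d v], rule has_derivative_transform_within_open)
  show "((\<lambda>y. local_rep (L t \<omega>) c d (snd c p, y)) has_derivative
    (\<lambda>v. frechet_derivative (local_rep (L t \<omega>) c d) (at (snd c p, snd d q)) (0, v))) (at (snd d q))"
    by (rule has_derivative_slice_snd[OF local_rep_cont_diff[OF L c d] chart_range_prod(2)[OF c d]])
  show "open (snd d ` fst d)" "snd d q \<in> snd d ` fst d"
    using d open_chart_range[OF Q] by (auto simp: charts_at_def)
  show "local_rep (L t \<omega>) c d (snd c p, y) = (L t \<omega> p \<circ> chart_inv d) y" if "y \<in> snd d ` fst d" for y
    using local_rep_apply[OF c charts_at_chart_inv(1)[OF Q _ that], of "L t \<omega>"]
      charts_at_chart_inv(2)[OF Q _ that] d by (simp add: charts_at_def)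
qed

lemma D3_in_chart:
  assumes L: "C2_lagrangian Q (L t \<omega>)" and c: "c \<in> charts_at Q p" and d: "d \<in> charts_at Q q"
    and v: "v \<in> tangent_space Q p"
  shows "D3 Q L t \<omega> p q v = frechet_derivative (local_rep (L t \<omega>) c d) (at (snd c p, snd d q)) (v c, 0)"
  unfolding D3_def
proof (rule differential_in_chart[OF Q c v], rule has_derivative_transform_within_open)
  show "((\<lambda>x. local_rep (L t \<omega>) c d (x, snd d q)) has_derivative
    (\<lambda>v. frechet_derivative (local_rep (L t \<omega>) c d) (at (snd c p, snd d q)) (v, 0))) (at (snd c p))"
    by (rule has_derivative_slice_fst[OF local_rep_cont_diff[OF L c d] chart_range_prod(2)[OF c d]])
  show "open (snd c ` fst c)" "snd c p \<in> snd c ` fst c"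
    using c open_chart_range[OF Q] by (auto simp: charts_at_def)
  show "local_rep (L t \<omega>) c d (x, snd d q) = ((\<lambda>p. L t \<omega> p q) \<circ> chart_inv c) x" if "x \<in> snd c ` fst c" for x
    using local_rep_apply[OF charts_at_chart_inv(1)[OF Q _ that] d, of "L t \<omega>"]
      charts_at_chart_inv(2)[OF Q _ that] c by (simp add: charts_at_def)
qed

text \<open>Pushing forward along the second projection keeps only the second component of the
  coordinate vector, and \<open>D4\<close> turns it into a partial derivative.\<close>

lemma coord_one_form_Theta_plus:
  assumes L: "C2_lagrangian Q (L t \<omega>)" and c: "c \<in> charts_at Q p" and d: "d \<in> charts_at Q q"
  shows "coord_one_form (prod_mfd Q Q) (prod_chart c d) (Theta_plus Q L t \<omega>) (snd c p, snd d q) w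
    = frechet_derivative (local_rep (L t \<omega>) c d) (at (snd c p, snd d q)) (0, snd w)"
proof -
  let ?Z = "prod_mfd Q Q" and ?C = "prod_chart c d"
  have Z: "differentiable_atlas ?Z" by (rule differentiable_atlas_prod[OF Q Q])
  have C: "?C \<in> charts_at ?Z (p, q)" using charts_at_prodI[of c Q "(p, q)" d Q] c d by simp
  have inv: "chart_inv ?C (snd c p, snd d q) = (p, q)"
    using chart_inv_apply[OF Z C] by simp
  let ?w = "tvec_of_coord ?Z ?C (p, q) w"
  let ?v = "push_forward ?Z Q snd (p, q) ?w"
  have "?v \<in> tangent_space Q (snd (p, q))"
    by (rule push_forward_in_tangent_space[OF Z Q differentiable_map_snd[OF Q Q] charts_at_in_points[OF Z C]])
  moreover have "?v d = snd (?w ?C)"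
    by (rule push_forward_in_chart[OF Z C tvec_of_coord_in_tangent_space[OF Z C]])
      (use d has_derivative_snd_in_prod_chart[OF Q Q c d] in simp_all)
  ultimately show ?thesis
    using D4_in_chart[of L t \<omega> c p d q ?v, OF L c d] tvec_of_coord_self[OF Z C, of w]
    by (simp add: coord_one_form_def Theta_plus_def inv)
qed

lemma Omega_Ld_in_some_chart:
  assumes L: "C2_lagrangian Q (L t \<omega>)" and c: "c \<in> charts_at Q p" and d: "d \<in> charts_at Q q"
    and C: "some_chart_at (prod_mfd Q Q) (p, q) = prod_chart c d"
  shows "Omega_Ld Q L t \<omega> (p, q) w1 w2
    = hessian (local_rep (L t \<omega>) c d) (snd c p, snd d q) (fst (w1 (prod_chart c d)), 0) (0, snd (w2 (prod_chart c d)))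
    - hessian (local_rep (L t \<omega>) c d) (snd c p, snd d q) (fst (w2 (prod_chart c d)), 0) (0, snd (w1 (prod_chart c d)))"
proof -
  let ?l = "local_rep (L t \<omega>) c d" and ?S = "snd c ` fst c \<times> snd d ` fst d"
  let ?\<theta> = "coord_one_form (prod_mfd Q Q) (prod_chart c d) (Theta_plus Q L t \<omega>)"
  note l = local_rep_cont_diff[OF L c d] and S = chart_range_prod[OF c d]
  \<comment> \<open>The coordinate vector \<open>w\<close> is held fixed while the base point
    varies, so differentiating the coefficient of the one-form gives a second derivative of the
    local Lagrangian.\<close>
  have "((\<lambda>x. ?\<theta> x w) has_derivative (\<lambda>u. hessian ?l (snd c p, snd d q) u (0, snd w))) (at (snd c p, snd d q))"
    for w
  proof (rule has_derivative_transform_within_open[OF hessian_works[OF l S(2)] S])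
    fix x assume "x \<in> ?S"
    then obtain p' q' where x: "x = (snd c p', snd d q')" "p' \<in> fst c" "q' \<in> fst d"
      by auto
    then have "c \<in> charts_at Q p'" "d \<in> charts_at Q q'"
      using c d by (auto simp: charts_at_def)
    then show "frechet_derivative ?l (at x) (0, snd w) = ?\<theta> x w"
      unfolding x(1) by (rule coord_one_form_Theta_plus[where L = L, OF L, symmetric])
  qed
  then have "frechet_derivative (\<lambda>x. ?\<theta> x w) (at (snd c p, snd d q)) u = hessian ?l (snd c p, snd d q) u (0, snd w)"
    for u w by (metis frechet_derivative_at)
  then show ?thesis
    using hessian_antisymmetrization_snd[OF l S]
    by (simp add: Omega_Ld_def ext_deriv_def Let_def C)
qed

text \<open>Moves from the chart picked by \<open>some_chart_at\<close> to prescribed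
  \<open>c\<close> and \<open>d\<close>, so that neighbouring steps of a path can share a chart at
  their common point. It rests on the tensoriality of the mixed second derivative.\<close>

lemma Omega_Ld_in_chart:
  assumes L: "C2_lagrangian Q (L t \<omega>)" and c: "c \<in> charts_at Q p" and d: "d \<in> charts_at Q q"
    and w: "w1 \<in> tangent_space (prod_mfd Q Q) (p, q)" "w2 \<in> tangent_space (prod_mfd Q Q) (p, q)"
  shows "Omega_Ld Q L t \<omega> (p, q) w1 w2
    = hessian (local_rep (L t \<omega>) c d) (snd c p, snd d q) (fst (w1 (prod_chart c d)), 0) (0, snd (w2 (prod_chart c d)))
    - hessian (local_rep (L t \<omega>) c d) (snd c p, snd d q) (fst (w2 (prod_chart c d)), 0) (0, snd (w1 (prod_chart c d)))"
proof -
  let ?Z = "prod_mfd Q Q"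
  have Z: "differentiable_atlas ?Z" by (rule differentiable_atlas_prod[OF Q Q])
  have C: "prod_chart c d \<in> charts_at ?Z (p, q)" using charts_at_prodI[of c Q "(p, q)" d Q] c d by simp
  have "some_chart_at ?Z (p, q) \<in> charts_at ?Z (p, q)"
    by (rule some_chart_at[OF Z charts_at_in_points[OF Z C]])
  then obtain c0 d0 where C0: "some_chart_at ?Z (p, q) = prod_chart c0 d0"
    and c0: "c0 \<in> charts_at Q p" and d0: "d0 \<in> charts_at Q q"
    by (elim charts_at_prodE) simp
  have C0': "prod_chart c0 d0 \<in> charts_at ?Z (p, q)" using charts_at_prodI[of c0 Q "(p, q)" d0 Q] c0 d0 by simp
  let ?S = "snd c0 ` (fst c0 \<inter> fst c) \<times> snd d0 ` (fst d0 \<inter> fst d)"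
  have S: "open ?S" "(snd c0 p, snd d0 q) \<in> ?S"
    using c c0 d d0
    by (auto simp: charts_at_def intro!: open_Times open_chart_image[OF Q _ openin_chart[OF Q]])
  have l0: "n_times_cont_diff_on 2 ?S (local_rep (L t \<omega>) c0 d0)"
    by (rule n_times_cont_diff_on_subset[OF local_rep_cont_diff[OF L c0 d0]]) auto
  have T: "(transition c0 c x, transition d0 d y) \<in> snd c ` fst c \<times> snd d ` fst d \<and>
      local_rep (L t \<omega>) c0 d0 (x, y) = local_rep (L t \<omega>) c d (transition c0 c x, transition d0 d y)"
    if "(x, y) \<in> ?S" for x y
  proof -
    from that obtain p' q' where xy: "x = snd c0 p'" "y = snd d0 q'"
      "p' \<in> fst c0" "p' \<in> fst c" "q' \<in> fst d0" "q' \<in> fst d" by auto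
    then have *: "c0 \<in> charts_at Q p'" "c \<in> charts_at Q p'" "d0 \<in> charts_at Q q'" "d \<in> charts_at Q q'"
      using c c0 d d0 by (auto simp: charts_at_def)
    show ?thesis
      using xy by (simp add: transition_apply[OF Q *(1)] transition_apply[OF Q *(3)]
          local_rep_apply[OF *(1,3)] local_rep_apply[OF *(2,4)])
  qed
  let ?\<sigma> = "frechet_derivative (transition c0 c) (at (snd c0 p))"
  let ?\<tau> = "frechet_derivative (transition d0 d) (at (snd d0 q))"
  have mixed: "hessian (local_rep (L t \<omega>) c0 d0) (snd c0 p, snd d0 q) (u, 0) (0, v)
      = hessian (local_rep (L t \<omega>) c d) (snd c p, snd d q) (?\<sigma> u, 0) (0, ?\<tau> v)" for u v
    using mixed_hessian_coordinate_change[OF l0 S local_rep_cont_diff[OF L c d] T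
        transition_works[OF Q c0 c] transition_works[OF Q d0 d]]
    by (simp add: transition_apply[OF Q c0] transition_apply[OF Q d0])
  \<comment> \<open>Tangency of \<open>w\<close> relates its coordinates in the two product charts,
    and the block diagonal derivative treats the two components separately.\<close>
  have "w (prod_chart c d) = (?\<sigma> (fst (w (prod_chart c0 d0))), ?\<tau> (snd (w (prod_chart c0 d0))))"
    if "w \<in> tangent_space ?Z (p, q)" for w
  proof -
    have "w (prod_chart c d) = frechet_derivative (transition (prod_chart c0 d0) (prod_chart c d))
        (at (snd (prod_chart c0 d0) (p, q))) (w (prod_chart c0 d0))"
      by (rule tangent_spaceD[OF that C0' C])
    then show ?thesis
      by (simp only: snd_prod_chart
          frechet_derivative_at[OF transition_prod_chart_has_derivative[OF Q Q c0 c d0 d], symmetric])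
  qed
  from this[OF w(1)] this[OF w(2)] show ?thesis
    by (simp add: Omega_Ld_in_some_chart[where L = L, OF L c0 d0 C0] mixed)
qed

end

section \<open>Symplecticity of the discrete flow\<close>

text \<open>The statement for a fixed outcome \<omega>: the forms at all steps are pulled back to
  the initial conditions, where the pullbacks at steps \<open>k\<close> and \<open>Suc k\<close>
  coincide; induction on \<open>k\<close> then connects step 0 with step \<open>n\<close>.\<close>

lemma Omega_Ld_preserved:
  fixes Q :: "('q, 'e::euclidean_space) mfd" and q :: "nat \<Rightarrow> 'q \<times> 'q \<Rightarrow> 'q"
  assumes Q: "differentiable_atlas Q" and L: "\<And>k. C2_lagrangian Q (L (t k) \<omega>)"
    and q: "\<And>k. k \<le> Suc n \<Longrightarrow> differentiable_map (prod_mfd Q Q) Q (q k)"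
    and init: "\<And>x. x \<in> points (prod_mfd Q Q) \<Longrightarrow> q 0 x = fst x \<and> q 1 x = snd x"
    and EL: "\<And>k x v. k < n \<Longrightarrow> x \<in> points (prod_mfd Q Q) \<Longrightarrow> v \<in> tangent_space Q (q (Suc k) x) \<Longrightarrow>
      D3 Q L (t (Suc k)) \<omega> (q (Suc k) x) (q (Suc (Suc k)) x) v + D4 Q L (t k) \<omega> (q k x) (q (Suc k) x) v = 0"
    and x: "x \<in> points (prod_mfd Q Q)"
    and w: "w1 \<in> tangent_space (prod_mfd Q Q) x" "w2 \<in> tangent_space (prod_mfd Q Q) x"
  shows "Omega_Ld Q L (t n) \<omega> (q n x, q (Suc n) x)
      (push_forward (prod_mfd Q Q) (prod_mfd Q Q) (\<lambda>x. (q n x, q (Suc n) x)) x w1)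
      (push_forward (prod_mfd Q Q) (prod_mfd Q Q) (\<lambda>x. (q n x, q (Suc n) x)) x w2)
    = Omega_Ld Q L (t 0) \<omega> x w1 w2"
proof -
  let ?Z = "prod_mfd Q Q"
  have Z: "differentiable_atlas ?Z" by (rule differentiable_atlas_prod[OF Q Q])
  define C where "C = some_chart_at ?Z x"
  have C: "C \<in> charts_at ?Z x" unfolding C_def by (rule some_chart_at[OF Z x])
  then have C_atlas: "C \<in> mfd_atlas ?Z" by (simp add: charts_at_def)
  define \<xi> where "\<xi> = snd C x"
  \<comment> \<open>One chart per point of the path: \<open>e (Suc k)\<close> serves as the second
    chart at step \<open>k\<close> and as the first chart at step \<open>Suc k\<close>.\<close>
  define e where "e k = some_chart_at Q (q k x)" for k
  have cont: "continuous_map (mfd_top ?Z) (mfd_top Q) (q k)" if "k \<le> Suc n" for k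
    using q[OF that] by (simp add: differentiable_map_def)
  have e: "e k \<in> charts_at Q (q k x)" if "k \<le> Suc n" for k
    unfolding e_def
    by (rule some_chart_at[OF Q]) (use continuous_map_image_subset_topspace[OF cont[OF that]] x in blast)
  define y where "y k = snd (e k) \<circ> q k \<circ> chart_inv C" for k
  define Y where "Y k = frechet_derivative (y k) (at \<xi>)" for k
  have dy: "(y k has_derivative Y k) (at \<xi>)" if "k \<le> Suc n" for k
    unfolding y_def Y_def \<xi>_def by (rule differentiable_map_works[OF q[OF that] C e[OF that]])
  have y_at: "y k (snd C x') = snd (e k) (q k x')" if "C \<in> charts_at ?Z x'" for k x'
    using chart_inv_apply[OF Z that] by (simp add: y_def)
  have y\<xi>: "y k \<xi> = snd (e k) (q k x)" for k
    unfolding \<xi>_def by (rule y_at[OF C])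
  define l where "l k = local_rep (L (t k) \<omega>) (e k) (e (Suc k))" for k
  \<comment> \<open>The pullback of the symplectic form at step \<open>k\<close> along
    \<open>(q k, q (Suc k))\<close>, with \<open>a\<close> and \<open>b\<close> coordinate vectors
    in the chart \<open>C\<close> of the initial conditions.\<close>
  define om where "om k a b = hessian (l k) (y k \<xi>, y (Suc k) \<xi>) (Y k a, 0) (0, Y (Suc k) b)
    - hessian (l k) (y k \<xi>, y (Suc k) \<xi>) (Y k b, 0) (0, Y (Suc k) a)" for k a b
  have step: "om k a b = om (Suc k) a b" if k: "k < n" for k a b
  proof -
    have k': "k \<le> Suc n" "Suc k \<le> Suc n" "Suc (Suc k) \<le> Suc n" using k by auto
    \<comment> \<open>Coordinates of initial conditions whose point \<open>q j\<close> stays in the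
      chart \<open>e j\<close>. On the intersection of three such sets the Euler-Lagrange equation
      can be written in the fixed charts.\<close>
    define V where "V j = snd C ` (fst C \<inter> q j -` fst (e j))" for j
    have V: "open (V j)" "\<xi> \<in> V j" if "j \<le> Suc n" for j
      using open_chart_vimage[OF Z C_atlas cont[OF that] openin_chart[OF Q]] e[OF that] C
      by (auto simp: V_def charts_at_def \<xi>_def)
    note e0 = e[OF k'(1)] and e1 = e[OF k'(2)] and e2 = e[OF k'(3)]
    have EL': "frechet_derivative (l (Suc k)) (at (y (Suc k) \<zeta>, y (Suc (Suc k)) \<zeta>)) (v, 0)
      + frechet_derivative (l k) (at (y k \<zeta>, y (Suc k) \<zeta>)) (0, v) = 0"
      if \<zeta>: "\<zeta> \<in> V k \<inter> V (Suc k) \<inter> V (Suc (Suc k))" for \<zeta> v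
    proof -
      define x' where "x' = chart_inv C \<zeta>"
      have "\<zeta> \<in> snd C ` fst C" using \<zeta> by (auto simp: V_def)
      then have C': "C \<in> charts_at ?Z x'" and \<zeta>': "\<zeta> = snd C x'"
        using charts_at_chart_inv[OF Z C_atlas, of \<zeta>] by (simp_all add: x'_def)
      have in_e: "e j \<in> charts_at Q (q j x')" if "\<zeta> \<in> V j" "e j \<in> charts_at Q (q j x)" for j
      proof -
        from that(1) obtain x'' where x'': "\<zeta> = snd C x''" "x'' \<in> fst C" "q j x'' \<in> fst (e j)"
          by (auto simp: V_def)
        then have "x'' = x'"
          using chart_inv_apply[OF Z, of C x''] C_atlas by (simp add: x'_def charts_at_def)
        then show ?thesis using x'' that(2) by (simp add: charts_at_def)
      qed
      have e0': "e k \<in> charts_at Q (q k x')" and e1': "e (Suc k) \<in> charts_at Q (q (Suc k) x')"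
        and e2': "e (Suc (Suc k)) \<in> charts_at Q (q (Suc (Suc k)) x')"
        using in_e \<zeta> e0 e1 e2 by auto
      \<comment> \<open>Every coordinate vector \<open>v\<close> comes from a tangent vector, so the
        equation on tangent vectors holds in all coordinate directions.\<close>
      define u where "u = tvec_of_coord Q (e (Suc k)) (q (Suc k) x') v"
      have u: "u \<in> tangent_space Q (q (Suc k) x')" "u (e (Suc k)) = v"
        unfolding u_def
        by (rule tvec_of_coord_in_tangent_space[OF Q e1'], rule tvec_of_coord_self[OF Q e1'])
      show ?thesis
        using EL[OF k charts_at_in_points[OF Z C'] u(1)]
        unfolding D3_in_chart[where L = L, OF Q L e1' e2' u(1)] D4_in_chart[where L = L, OF Q L e0' e1' u(1)]
        by (simp add: u(2) l_def \<zeta>' y_at[OF C'])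
    qed
    show ?thesis
      unfolding om_def
    proof (rule discrete_Euler_Lagrange_mixed_hessian)
      show "n_times_cont_diff_on 2 (snd (e k) ` fst (e k) \<times> snd (e (Suc k)) ` fst (e (Suc k))) (l k)"
        unfolding l_def by (rule local_rep_cont_diff[OF Q L e0 e1])
      show "n_times_cont_diff_on 2 (snd (e (Suc k)) ` fst (e (Suc k))
          \<times> snd (e (Suc (Suc k))) ` fst (e (Suc (Suc k)))) (l (Suc k))"
        unfolding l_def by (rule local_rep_cont_diff[OF Q L e1 e2])
      show "open (V k \<inter> V (Suc k) \<inter> V (Suc (Suc k)))" "\<xi> \<in> V k \<inter> V (Suc k) \<inter> V (Suc (Suc k))"
        using V k' by (auto intro!: open_Int)
    qed (use chart_range_prod[OF Q e0 e1] chart_range_prod[OF Q e1 e2] dy k' EL' y\<xi> in simp_all)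
  qed
  have om: "om k a b = om 0 a b" if "k \<le> n" for k a b
    using that by (induction k) (use step in auto)
  have E: "prod_chart (e k) (e (Suc k)) \<in> charts_at ?Z (q k x, q (Suc k) x)" if "k \<le> n" for k
    by (rule charts_at_prodI) (use e that in auto)
  have coords: "((snd (prod_chart (e k) (e (Suc k))) \<circ> (\<lambda>x. (q k x, q (Suc k) x)) \<circ> chart_inv C)
      has_derivative (\<lambda>v. (Y k v, Y (Suc k) v))) (at \<xi>)" if "k \<le> n" for k
  proof -
    have "snd (prod_chart (e k) (e (Suc k))) \<circ> (\<lambda>x. (q k x, q (Suc k) x)) \<circ> chart_inv C
      = (\<lambda>\<zeta>. (y k \<zeta>, y (Suc k) \<zeta>))" by (auto simp: y_def)
    then show ?thesis using has_derivative_Pair[OF dy dy] that by simp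
  qed
  \<comment> \<open>In the charts at step \<open>n\<close> the induced variation has the coordinates
    used in \<open>om n\<close>.\<close>
  have final: "push_forward ?Z ?Z (\<lambda>x. (q n x, q (Suc n) x)) x w (prod_chart (e n) (e (Suc n)))
      = (Y n (w C), Y (Suc n) (w C))" if "w \<in> tangent_space ?Z x" for w
    by (rule push_forward_in_chart[OF Z C that E[OF order_refl] coords[OF order_refl, unfolded \<xi>_def]])
  have x01: "(q 0 x, q (Suc 0) x) = x" using init[OF x] by simp
  \<comment> \<open>At step 0 the map \<open>(q 0, q 1)\<close> is the identity on the points of the
    manifold, so in coordinates it agrees with a transition map on the range of \<open>C\<close>.
    Hence \<open>w\<close> itself has the coordinates used in \<open>om 0\<close>.\<close>
  have start: "w (prod_chart (e 0) (e (Suc 0))) = (Y 0 (w C), Y (Suc 0) (w C))"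
    if "w \<in> tangent_space ?Z x" for w
  proof -
    have E0: "prod_chart (e 0) (e (Suc 0)) \<in> charts_at ?Z x"
      using E[of 0] by (simp add: x01)
    have "(transition C (prod_chart (e 0) (e (Suc 0))) has_derivative (\<lambda>v. (Y 0 v, Y (Suc 0) v))) (at \<xi>)"
    proof (rule has_derivative_transform_within_open[OF coords])
      show "open (snd C ` fst C)" "\<xi> \<in> snd C ` fst C"
        using C open_chart_range[OF Z C_atlas] by (auto simp: charts_at_def \<xi>_def)
      fix \<zeta> assume "\<zeta> \<in> snd C ` fst C"
      then have "chart_inv C \<zeta> \<in> points ?Z"
        by (rule charts_at_in_points[OF Z charts_at_chart_inv(1)[OF Z C_atlas]])
      from init[OF this]
      show "(snd (prod_chart (e 0) (e (Suc 0))) \<circ> (\<lambda>x. (q 0 x, q (Suc 0) x)) \<circ> chart_inv C) \<zeta>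
        = transition C (prod_chart (e 0) (e (Suc 0))) \<zeta>"
        by (simp add: transition_def)
    qed simp
    from frechet_derivative_at[OF this] show ?thesis
      unfolding tangent_spaceD[OF that C E0] \<xi>_def[symmetric] by (simp only: fun_eq_iff)
  qed
  have flow: "differentiable_map ?Z ?Z (\<lambda>x. (q n x, q (Suc n) x))"
    by (rule differentiable_map_Pair) (use q in auto)
  have "Omega_Ld Q L (t n) \<omega> (q n x, q (Suc n) x)
      (push_forward ?Z ?Z (\<lambda>x. (q n x, q (Suc n) x)) x w1)
      (push_forward ?Z ?Z (\<lambda>x. (q n x, q (Suc n) x)) x w2) = om n (w1 C) (w2 C)"
    using Omega_Ld_in_chart[where L = L and t = "t n", OF Q L e[of n] e[of "Suc n"]
        push_forward_in_tangent_space[OF Z Z flow x] push_forward_in_tangent_space[OF Z Z flow x]]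
    by (simp add: final w om_def l_def y\<xi>)
  also have "\<dots> = om 0 (w1 C) (w2 C)" by (rule om) simp
  also have "\<dots> = Omega_Ld Q L (t 0) \<omega> (q 0 x, q (Suc 0) x) w1 w2"
    using Omega_Ld_in_chart[where L = L and t = "t 0", OF Q L e[of 0] e[of "Suc 0"], of w1 w2] w
    by (simp add: x01 start om_def l_def y\<xi>)
  finally show ?thesis unfolding x01 .
qed

section \<open>Passage to the almost sure statement\<close>

lemma DEL_path_solution:
  assumes "\<exists>!q. DEL_solution Q L a b N \<omega> (fst x) (snd x) q"
  shows "DEL_solution Q L a b N \<omega> (fst x) (snd x) (DEL_path Q L a b N \<omega> x)"
  unfolding DEL_path_def by (rule theI'[OF assms])

theorem mainTheorem3:
  fixes Q :: "('q, 'e::euclidean_space) mfd"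
    and P :: "'w measure"
    and L0 :: "'q \<Rightarrow> 'q \<Rightarrow> real"
    and B :: "real \<Rightarrow> 'q \<Rightarrow> 'q \<Rightarrow> 'w \<Rightarrow> real"
    and L :: "real \<Rightarrow> 'w \<Rightarrow> 'q \<Rightarrow> 'q \<Rightarrow> real"
    and a b :: real and N :: nat and r :: enat
  assumes "smooth_manifold Q"
    and "prob_space P"
    and "a < b" and "N \<ge> 2"
    and "stochastic_discrete_lagrangian P Q L0 B L"
    and "r \<ge> 2"
    and "\<forall>t. \<forall>\<omega>\<in>space P. C_class_map r (prod_mfd Q Q) real_mfd (\<lambda>(q, q'). L t \<omega> q q')"
    and "AE \<omega> in P.
           (\<forall>q0\<in>points Q. \<forall>q1\<in>points Q. \<exists>!q. DEL_solution Q L a b N \<omega> q0 q1 q) \<and>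
           (\<forall>k\<le>N. C_class_map (r - 1) (prod_mfd Q Q) Q (\<lambda>x. DEL_path Q L a b N \<omega> x k))"
  shows "AE \<omega> in P.
           \<forall>x\<in>points (prod_mfd Q Q).
           \<forall>w1\<in>tangent_space (prod_mfd Q Q) x. \<forall>w2\<in>tangent_space (prod_mfd Q Q) x.
             Omega_Ld Q L (grid a b N (N - 1)) \<omega> (discrete_flow Q L a b N \<omega> x)
               (push_forward (prod_mfd Q Q) (prod_mfd Q Q) (discrete_flow Q L a b N \<omega>) x w1)
               (push_forward (prod_mfd Q Q) (prod_mfd Q Q) (discrete_flow Q L a b N \<omega>) x w2)
             = Omega_Ld Q L (grid a b N 0) \<omega> x w1 w2"
  \<comment> \<open>\<open>AE_space\<close> supplies \<open>\<omega> \<in> space P\<close>, where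
    the regularity of \<open>L\<close> is assumed; from here on the outcome is fixed.\<close>
  using assms(8) AE_space
proof eventually_elim
  case (elim \<omega>)
  have Q: "differentiable_atlas Q"
    by (rule differentiable_atlas_if_smooth_manifold[OF assms(1)])
  have L: "C2_lagrangian Q (L t \<omega>)" for t
    using C2_lagrangian_if_C_class_map[of r Q "L t \<omega>"] assms(6,7) elim(2) by blast
  \<comment> \<open>Since \<open>r\<close> is at least 2, solutions of class \<open>r - 1\<close>
    depend at least once differentiably on the initial condition.\<close>
  have r1: "1 \<le> r - 1"
    using assms(6) by (cases r) (auto simp: one_enat_def numeral_eq_enat)
  \<comment> \<open>With \<open>N = Suc n\<close> the flow is the pair of positions \<open>n\<close>
    and \<open>Suc n\<close>, and the time index \<open>N - 1\<close> becomes
    \<open>n\<close>.\<close>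
  obtain n where N: "N = Suc n" using assms(4) by (cases N) auto
  let ?q = "\<lambda>k x. DEL_path Q L a b N \<omega> x k"
  have q: "differentiable_map (prod_mfd Q Q) Q (?q k)" if "k \<le> Suc n" for k
    by (rule differentiable_map_if_C_class_map[OF _ r1]) (use elim(1) that N in blast)
  have sol: "DEL_solution Q L a b N \<omega> (fst x) (snd x) (DEL_path Q L a b N \<omega> x)"
    if "x \<in> points (prod_mfd Q Q)" for x
    by (rule DEL_path_solution) (use elim(1) that in \<open>simp add: mem_Times_iff\<close>)
  \<comment> \<open>Index shift: the equations for \<open>1, ..., N - 1\<close> become those for
    \<open>Suc k\<close> with \<open>k < n\<close>, which avoids natural number subtraction.\<close>
  have EL: "D3 Q L (grid a b N (Suc k)) \<omega> (?q (Suc k) x) (?q (Suc (Suc k)) x) v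
      + D4 Q L (grid a b N k) \<omega> (?q k x) (?q (Suc k) x) v = 0"
    if "k < n" "x \<in> points (prod_mfd Q Q)" "v \<in> tangent_space Q (?q (Suc k) x)" for k x v
  proof -
    have "\<forall>k\<in>{1..N - 1}. \<forall>v\<in>tangent_space Q (?q k x).
        D3 Q L (grid a b N k) \<omega> (?q k x) (?q (k + 1) x) v
        + D4 Q L (grid a b N (k - 1)) \<omega> (?q (k - 1) x) (?q k x) v = 0"
      using sol[OF that(2)] unfolding DEL_solution_def by blast
    moreover have "Suc k \<in> {1..N - 1}" using that(1) by (simp add: N)
    ultimately show ?thesis using that(3) by fastforce
  qed
  have flow: "discrete_flow Q L a b N \<omega> = (\<lambda>x. (?q n x, ?q (Suc n) x))"
    by (auto simp: discrete_flow_def N)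
  show ?case
  proof (intro ballI)
    fix x w1 w2 assume "x \<in> points (prod_mfd Q Q)"
      "w1 \<in> tangent_space (prod_mfd Q Q) x" "w2 \<in> tangent_space (prod_mfd Q Q) x"
    note xw = this
    have init: "?q 0 x = fst x \<and> ?q 1 x = snd x" if "x \<in> points (prod_mfd Q Q)" for x
      using sol[OF that] by (simp add: DEL_solution_def)
    have n: "N - 1 = n" by (simp add: N)
    show "Omega_Ld Q L (grid a b N (N - 1)) \<omega> (discrete_flow Q L a b N \<omega> x)
               (push_forward (prod_mfd Q Q) (prod_mfd Q Q) (discrete_flow Q L a b N \<omega>) x w1)
               (push_forward (prod_mfd Q Q) (prod_mfd Q Q) (discrete_flow Q L a b N \<omega>) x w2)
             = Omega_Ld Q L (grid a b N 0) \<omega> x w1 w2"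
      unfolding flow n
      by (rule Omega_Ld_preserved[where t = "grid a b N" and q = ?q, OF Q L q init EL xw])
  qed
qed

end
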